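(* Let $n$ be a positive rational number and $G_n$ Ramanujan's class invariant. Then $$S_2\!\left(e^{-3\pi\sqrt{n}}\right)=\frac{1}{\sqrt{2}}\left(G^{12}_n-\sqrt{G^{24}_n-1}\right)^{1/4}\left(G^{4}_n-\sqrt{G^{8}_n-1}\right)^{1/2}\left(\sqrt{\frac{G^8_n+1+\sqrt{G^{16}_n+G^{8}_n+1}}{2}}-\sqrt{\frac{G^8_n-1+\sqrt{G^{16}_n+G^{8}_n+1}}{2}}\right),$$ $$S_2\!\left(e^{-\pi\sqrt{n}/3}\right)=\frac{1}{\sqrt{2}}\left(G^{12}_n-\sqrt{G^{24}_n-1}\right)^{1/4}\left(G^{4}_n-\sqrt{G^{8}_n-1}\right)^{1/2}\left(\sqrt{\frac{G^8_n+1+\sqrt{G^{16}_n+G^{8}_n+1}}{2}}+\sqrt{\frac{G^8_n-1+\sqrt{G^{16}_n+G^{8}_n+1}}{2}}\right).$$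
   Context: For $|x|<1$ let $(a;x)_\infty=\prod_{k\ge0}(1-ax^k)$, $f(-x)=(x;x)_\infty$ and $f(x)=(-x;-x)_\infty$. For $0<q<1$, $S_2(q)=\dfrac{q^{1/8}(-q^2;q^2)_\infty}{(q;q^2)_\infty}$ (equal to the continued fraction $\frac{q^{1/8}}{1+}\frac{-q}{1+}\frac{-q+q^2}{1+}\frac{-q^3}{1+}\frac{q^2+q^4}{1+}\cdots$). For positive real $r$, $G_r=\dfrac{f(q)}{2^{1/4}q^{1/24}f(-q^2)}$ with $q=e^{-\pi\sqrt r}$. All roots are nonnegative real roots.
   Formalization: The identities are proved for n ≥ 1 instead of all positive rational n; for 0 < n < 1 they are false, since G_{1/n} = G_n leaves the right-hand sides unchanged while S_2(q) is strictly increasing in q. *)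

theory Defs
  imports "HOL-Analysis.Analysis"
begin

text \<open>All functions below are intended for a base of absolute value less than 1, where the
  infinite products converge; outside that range the value of \<^const>\<open>prodinf\<close> carries no meaning.\<close>

definition qpoch_inf :: "real \<Rightarrow> real \<Rightarrow> real" where
  "qpoch_inf a x = (\<Prod>k. 1 - a * x ^ k)"

text \<open>Ramanujan's \<open>f\<close> in one variable. The argument is the negative of the base, so that
  \<open>f (- x) = (x; x)\<close> and \<open>f x = (- x; - x)\<close>.\<close>

definition ramanujan_f :: "real \<Rightarrow> real" where
  "ramanujan_f x = qpoch_inf (- x) (- x)"

definition S2 :: "real \<Rightarrow> real" where
  "S2 q = root 8 q * qpoch_inf (- (q\<^sup>2)) (q\<^sup>2) / qpoch_inf q (q\<^sup>2)"

definition class_invariant_G :: "real \<Rightarrow> real" where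
  "class_invariant_G r =
    (let q = exp (- (pi * sqrt r))
     in ramanujan_f q / (root 4 2 * root 24 q * ramanujan_f (- (q\<^sup>2))))"

end

theory Submission
  imports Defs "HOL-Real_Asymp.Real_Asymp"
begin

text \<open>With \<open>q = exp (- s)\<close> the triple product gives \<open>2 S\<^sub>2(q)\<^sup>2 = \<theta>\<^sub>2/\<theta>\<^sub>4\<close>; call this \<open>x\<close>. Jacobi's
  quartic identity turns the class invariant into \<open>2 G\<^sup>1\<^sup>2 = x\<^sup>2 + 1/x\<^sup>2\<close>, and the cubic theta identity
  \<open>\<theta>\<^sub>3(q)\<theta>\<^sub>3(q\<^sup>3) = \<theta>\<^sub>2(q)\<theta>\<^sub>2(q\<^sup>3) + \<theta>\<^sub>4(q)\<theta>\<^sub>4(q\<^sup>3)\<close> becomes \<open>(1 + x y)\<^sup>4 = (1 + x\<^sup>4)(1 + y\<^sup>4)\<close>, which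
  holds for the values \<open>y\<close> at \<open>q\<^sup>3\<close> and at \<open>q\<close> to the power \<open>1/3\<close>. As a quartic in \<open>y\<close> it has exactly two
  positive roots, and monotonicity of \<open>S\<^sub>2\<close> tells them apart. The choice of square root for \<open>x\<^sup>2\<close>
  needs \<open>x \<le> 1\<close>, which by monotonicity reduces to \<open>\<theta>\<^sub>2 = \<theta>\<^sub>4\<close> at \<open>q = exp (- \<pi>)\<close>; this instance of
  the theta transformation is obtained by Polya's elementary argument with binomial sums.\<close>

section \<open>The Jacobi triple product\<close>

text \<open>Tannery's theorem carried from series over the naturals to sums over the integers by the
  enumeration \<open>int_decode\<close>. It justifies the passage to the limit in the triple product
  and on both sides of Polya's argument.\<close>

lemma tendsto_infsum_int_dominated:
  fixes a :: "nat \<Rightarrow> int \<Rightarrow> real"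
  assumes lim: "\<And>k. (\<lambda>n. a n k) \<longlonglongrightarrow> b k"
    and bound: "\<forall>\<^sub>F n in sequentially. \<forall>k. \<bar>a n k\<bar> \<le> M k"
    and M: "M summable_on UNIV"
  shows "(\<lambda>n. \<Sum>\<^sub>\<infinity>k. a n k) \<longlonglongrightarrow> (\<Sum>\<^sub>\<infinity>k. b k)"
proof -
  have suminf_eq: "(\<Sum>k. f (int_decode k)) = (\<Sum>\<^sub>\<infinity>k. f k)" if "f summable_on UNIV" for f :: "int \<Rightarrow> real"
  proof -
    have "((\<lambda>k. f (int_decode k)) has_sum (\<Sum>\<^sub>\<infinity>k. f k)) UNIV"
      using has_sum_reindex_bij_betw[OF bij_int_decode] that by (metis has_sum_infsum)
    then show ?thesis
      by (metis has_sum_imp_sums sums_unique)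
  qed
  have summ: "f summable_on UNIV" if "\<And>k. \<bar>f k\<bar> \<le> M k" for f :: "int \<Rightarrow> real"
    using Infinite_Sum.abs_summable_on_comparison_test'[OF M, of f] that abs_summable_summable by fastforce
  have b_le: "\<bar>b k\<bar> \<le> M k" for k
    by (rule tendsto_upperbound[OF tendsto_rabs[OF lim]]) (use bound in \<open>auto elim: eventually_mono\<close>)
  have bsum: "b summable_on UNIV"
    using summ b_le by blast
  have Ms: "summable (\<lambda>k. M (int_decode k))"
    using M summable_on_reindex_bij_betw[OF bij_int_decode] summable_on_imp_summable by metis
  have "\<forall>\<^sub>F (k, n) in at_top \<times>\<^sub>F sequentially. norm (a n (int_decode k)) \<le> M (int_decode k)"
    unfolding eventually_prod_filter
    by (rule exI[of _ "\<lambda>_. True"], rule exI[of _ "\<lambda>n. \<forall>k. \<bar>a n k\<bar> \<le> M k"]) (use bound in auto)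
  from tannerys_theorem[OF lim this Ms]
  have "(\<lambda>n. \<Sum>k. a n (int_decode k)) \<longlonglongrightarrow> (\<Sum>k. b (int_decode k))" by simp
  moreover have "\<forall>\<^sub>F n in sequentially. (\<Sum>k. a n (int_decode k)) = (\<Sum>\<^sub>\<infinity>k. a n k)"
    using bound by eventually_elim (rule suminf_eq, rule summ, blast)
  ultimately show "(\<lambda>n. \<Sum>\<^sub>\<infinity>k. a n k) \<longlonglongrightarrow> (\<Sum>\<^sub>\<infinity>k. b k)"
    using suminf_eq[OF bsum] by (simp add: tendsto_cong)
qed

section \<open>Infinite q-Pochhammer products\<close>

lemma convergent_prod_qpoch:
  assumes "\<bar>x\<bar> < 1"
  shows "convergent_prod (\<lambda>k. 1 - a * x ^ k :: real)"
proof -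
  have "summable (\<lambda>k. norm (- a * x ^ k))"
    using assms summable_mult[OF summable_geometric[of "\<bar>x\<bar>"], of "\<bar>a\<bar>"]
    by (simp add: abs_mult power_abs)
  then have "abs_convergent_prod (\<lambda>k. 1 + (- a * x ^ k))"
    by (intro summable_imp_abs_convergent_prod) simp
  then show ?thesis
    using abs_convergent_prod_imp_convergent_prod by fastforce
qed

lemma qpoch_inf_LIMSEQ:
  assumes "\<bar>x\<bar> < 1"
  shows "(\<lambda>n. \<Prod>k<n. 1 - a * x ^ k) \<longlonglongrightarrow> qpoch_inf a x"
proof -
  have "(\<lambda>n. \<Prod>k\<le>n. 1 - a * x ^ k) \<longlonglongrightarrow> qpoch_inf a x"
    unfolding qpoch_inf_def by (rule convergent_prod_LIMSEQ[OF convergent_prod_qpoch[OF assms]])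
  then show ?thesis
    by (simp add: LIMSEQ_lessThan_iff_atMost)
qed

lemma qpoch_factor_pos:
  fixes a x :: real
  assumes "0 \<le> x" "x < 1" "a < 1"
  shows "1 - a * x ^ k > 0"
proof (cases "a \<ge> 0")
  case True
  have "a * x ^ k \<le> a * 1"
    using assms True by (intro mult_left_mono power_le_one) auto
  with assms show ?thesis by simp
next
  case False
  then have "a * x ^ k \<le> 0"
    using assms by (simp add: mult_nonpos_nonneg)
  then show ?thesis by simp
qed

lemma qpoch_inf_pos:
  assumes "0 \<le> x" "x < 1" "a < 1"
  shows "qpoch_inf a x > 0"
  unfolding qpoch_inf_def
  using assms qpoch_factor_pos by (intro less_0_prodinf convergent_prod_qpoch) auto

text \<open>All factors are positive, so the partial products compare factor by factor and the limit
  preserves the order. Parameter and base vary together because both change with the nome in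
  \<open>S2\<close>.\<close>

lemma qpoch_inf_antimono:
  assumes x: "0 \<le> x" "x < 1" and x': "0 \<le> x'" "x' < 1" and a: "a < 1" and a': "a' < 1"
    and le: "\<And>k. a * x ^ k \<le> a' * x' ^ k"
  shows "qpoch_inf a' x' \<le> qpoch_inf a x"
proof (rule LIMSEQ_le[OF qpoch_inf_LIMSEQ qpoch_inf_LIMSEQ])
  show "\<exists>N. \<forall>n\<ge>N. (\<Prod>k<n. 1 - a' * x' ^ k) \<le> (\<Prod>k<n. 1 - a * x ^ k)"
    using le qpoch_factor_pos[OF x' a'] by (intro exI allI impI prod_mono) (auto simp: less_imp_le)
qed (use x x' in auto)

lemma qpoch_inf_split_first:
  assumes "\<bar>x\<bar> < 1"
  shows "qpoch_inf a x = (1 - a) * qpoch_inf (a * x) x"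
proof -
  have "(\<lambda>n. \<Prod>k<Suc n. 1 - a * x ^ k) \<longlonglongrightarrow> qpoch_inf a x"
    using qpoch_inf_LIMSEQ[OF assms] by (rule LIMSEQ_Suc)
  moreover have "(\<Prod>k<Suc n. 1 - a * x ^ k) = (1 - a) * (\<Prod>k<n. 1 - (a * x) * x ^ k)" for n
    by (subst prod.lessThan_Suc_shift) (simp add: mult.assoc)
  moreover have "(\<lambda>n. (1 - a) * (\<Prod>k<n. 1 - (a * x) * x ^ k)) \<longlonglongrightarrow> (1 - a) * qpoch_inf (a * x) x"
    by (intro tendsto_intros qpoch_inf_LIMSEQ assms)
  ultimately show ?thesis
    using LIMSEQ_unique by simp
qed

lemma qpoch_inf_even_odd:
  assumes "\<bar>x\<bar> < 1"
  shows "qpoch_inf a x = qpoch_inf a (x\<^sup>2) * qpoch_inf (a * x) (x\<^sup>2)"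
proof -
  have x2: "\<bar>x\<^sup>2\<bar> < 1"
    using assms by (simp add: abs_square_less_1)
  have "(\<lambda>n. \<Prod>k<2 * n. 1 - a * x ^ k) \<longlonglongrightarrow> qpoch_inf a x"
    using LIMSEQ_subseq_LIMSEQ[OF qpoch_inf_LIMSEQ[OF assms, of a], of "\<lambda>n. 2 * n"]
    by (simp add: o_def strict_mono_def)
  moreover have "(\<Prod>k<2 * n. 1 - a * x ^ k) =
      (\<Prod>k<n. 1 - a * (x\<^sup>2) ^ k) * (\<Prod>k<n. 1 - a * x * (x\<^sup>2) ^ k)" for n
    by (induction n) (auto simp: power_mult[symmetric] mult.assoc mult.left_commute)
  moreover have "(\<lambda>n. (\<Prod>k<n. 1 - a * (x\<^sup>2) ^ k) * (\<Prod>k<n. 1 - a * x * (x\<^sup>2) ^ k))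
      \<longlonglongrightarrow> qpoch_inf a (x\<^sup>2) * qpoch_inf (a * x) (x\<^sup>2)"
    by (intro tendsto_intros qpoch_inf_LIMSEQ x2)
  ultimately show ?thesis
    using LIMSEQ_unique by simp
qed

lemma qpoch_inf_plus_minus:
  assumes "\<bar>x\<bar> < 1"
  shows "qpoch_inf a x * qpoch_inf (- a) x = qpoch_inf (a\<^sup>2) (x\<^sup>2)"
proof -
  have x2: "\<bar>x\<^sup>2\<bar> < 1"
    using assms by (simp add: abs_square_less_1)
  have lim: "(\<lambda>n. (\<Prod>k<n. 1 - a * x ^ k) * (\<Prod>k<n. 1 - (- a) * x ^ k)) \<longlonglongrightarrow> qpoch_inf a x * qpoch_inf (- a) x"
    by (intro tendsto_intros qpoch_inf_LIMSEQ assms)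
  have eq: "(\<Prod>k<n. 1 - a * x ^ k) * (\<Prod>k<n. 1 - (- a) * x ^ k) = (\<Prod>k<n. 1 - a\<^sup>2 * (x\<^sup>2) ^ k)" for n
    by (simp add: prod.distrib[symmetric] power_mult[symmetric] algebra_simps power2_eq_square power_mult_distrib)
  show ?thesis
    using LIMSEQ_unique[OF lim[unfolded eq] qpoch_inf_LIMSEQ[OF x2]] .
qed

section \<open>Finite form of the triple product\<close>

definition qfact :: "real \<Rightarrow> nat \<Rightarrow> real" where
  "qfact p n = (\<Prod>k<n. 1 - p * p ^ k)"

text \<open>The value \<open>0\<close> at negative arguments lets the coefficients of the finite triple product
  be indexed by all integers.\<close>

definition inv_qfact :: "real \<Rightarrow> int \<Rightarrow> real" where
  "inv_qfact p k = (if k < 0 then 0 else 1 / qfact p (nat k))"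

lemma qfact_pos: "0 \<le> p \<Longrightarrow> p < 1 \<Longrightarrow> qfact p n > 0"
  unfolding qfact_def using qpoch_factor_pos[of p p] by (intro prod_pos) auto

text \<open>The zero convention keeps the recurrence valid on all integers: at \<open>k = 0\<close>
  the factor \<open>1 - p powi k\<close> vanishes, matching the zero on the left.\<close>

lemma inv_qfact_step:
  assumes "0 \<le> p" "p < 1"
  shows "inv_qfact p (k - 1) = (1 - p powi k) * inv_qfact p k"
proof -
  consider "k < 0" | "k = 0" | j where "k = int (Suc j)"
    by (metis int_cases not0_implies_Suc of_nat_0 negative_zless)
  then show ?thesis
  proof cases
    case 3
    have "k - 1 = int j" "\<not> k < 0" "nat k = Suc j" "p powi k = p * p ^ j"
      using 3 by (auto simp: power_int_def nat_add_distrib)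
    then show ?thesis
      using qfact_pos[OF assms, of j] qfact_pos[OF assms, of "Suc j"] 
      by (auto simp: inv_qfact_def qfact_def zero_less_mult_iff)
  qed (auto simp: inv_qfact_def)
qed

text \<open>The Gaussian binomial coefficient of \<open>m + n\<close> over \<open>n + j\<close> in
  base \<open>p\<close>, centred so that its support is \<open>- n \<le> j \<le> m\<close>.\<close>

definition qbinom_coeff :: "real \<Rightarrow> nat \<Rightarrow> nat \<Rightarrow> int \<Rightarrow> real" where
  "qbinom_coeff p m n j = qfact p (m + n) * inv_qfact p (int m - j) * inv_qfact p (int n + j)"

text \<open>The q-Pascal rule. With \<open>u = p powi (m + 1 - j)\<close> and
  \<open>v = p powi (n + j)\<close> it reduces to
  \<open>1 - u * v = (1 - u) + u * (1 - v)\<close>.\<close>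

lemma qbinom_coeff_Suc_left:
  assumes p: "0 < p" "p < 1"
  shows "qbinom_coeff p (Suc m) n j =
    qbinom_coeff p m n j + p powi (int m + 1 - j) * qbinom_coeff p m n (j - 1)"
proof -
  define a b where "a = inv_qfact p (int m + 1 - j)" and "b = inv_qfact p (int n + j)"
  have 1: "inv_qfact p (int m - j) = (1 - p powi (int m + 1 - j)) * a"
    using inv_qfact_step[of p "int m + 1 - j"] p by (simp add: a_def)
  have 2: "inv_qfact p (int n + j - 1) = (1 - p powi (int n + j)) * b"
    using inv_qfact_step[of p "int n + j"] p by (simp add: b_def)
  have 3: "qfact p (Suc m + n) = qfact p (m + n) * (1 - p powi (int m + 1 - j) * p powi (int n + j))"
  proof -
    have "p powi (int m + 1 - j) * p powi (int n + j) = p powi (int (Suc (m + n)))"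
      using p by (subst power_int_add[symmetric]) (auto simp: algebra_simps)
    also have "\<dots> = p * p ^ (m + n)"
      unfolding power_int_of_nat by simp
    finally show ?thesis by (simp add: qfact_def)
  qed
  have 4: "int (Suc m) - j = int m + 1 - j" "int m - (j - 1) = int m + 1 - j" 
    "int n + (j - 1) = int n + j - 1" by auto
  show ?thesis
    unfolding qbinom_coeff_def 4 1 2 3 a_def[symmetric] b_def[symmetric] by (simp add: algebra_simps)
qed

lemma qbinom_coeff_flip: "qbinom_coeff p m n j = qbinom_coeff p n m (- j)"
  by (simp add: qbinom_coeff_def add.commute)

text \<open>Multiplying by one more factor adds a copy of the sum with index shifted by one. Since
  \<open>(j - 1)^2 + 2 m + 1 = j^2 + 2 (m + 1 - j)\<close>, the shifted term carries exactly the
  weight of the q-Pascal rule.\<close>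

lemma finite_triple_product_Suc:
  fixes q z :: real
  assumes q: "0 < q" "q < 1" and z: "z \<noteq> 0"
    and IH: "((\<lambda>j. qbinom_coeff (q\<^sup>2) m n j * (q powi (j\<^sup>2) * z powi j)) has_sum S) UNIV"
  shows "((\<lambda>j. qbinom_coeff (q\<^sup>2) (Suc m) n j * (q powi (j\<^sup>2) * z powi j)) has_sum
            (S * (1 + z * q * (q\<^sup>2) ^ m))) UNIV"
proof -
  define h where "h = (\<lambda>j. qbinom_coeff (q\<^sup>2) m n j * (q powi (j\<^sup>2) * z powi j))"
  have p: "0 < q\<^sup>2" "q\<^sup>2 < 1"
    using q by (auto simp: abs_square_less_1)
  have "bij (\<lambda>j::int. j - 1)"
    by (rule bij_betw_byWitness[of _ "\<lambda>j. j + 1"]) auto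
  then have "((\<lambda>j. h (j - 1)) has_sum S) UNIV"
    using IH has_sum_reindex_bij_betw[of "\<lambda>j::int. j - 1" UNIV UNIV h S] by (simp add: h_def)
  then have "((\<lambda>j. h j + h (j - 1) * (z * q * (q\<^sup>2) ^ m)) has_sum (S + S * (z * q * (q\<^sup>2) ^ m))) UNIV"
    using IH by (intro has_sum_add has_sum_cmult_left) (simp_all add: h_def)
  moreover have "h j + h (j - 1) * (z * q * (q\<^sup>2) ^ m) =
      qbinom_coeff (q\<^sup>2) (Suc m) n j * (q powi (j\<^sup>2) * z powi j)" for j
  proof -
    have "q powi ((j - 1)\<^sup>2) * (q * (q\<^sup>2) ^ m) = q powi ((j - 1)\<^sup>2 + (1 + 2 * int m))"
      using q by (simp add: power_int_add power_int_mult)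
    also have "(j - 1)\<^sup>2 + (1 + 2 * int m) = 2 * (int m + 1 - j) + j\<^sup>2"
      by (simp add: power2_eq_square algebra_simps)
    also have "q powi \<dots> = (q\<^sup>2) powi (int m + 1 - j) * q powi (j\<^sup>2)"
      using q power_int_mult[of q 2 "int m + 1 - j"] by (simp add: power_int_add)
    finally have 1: "q powi ((j - 1)\<^sup>2) * (q * (q\<^sup>2) ^ m) = (q\<^sup>2) powi (int m + 1 - j) * q powi (j\<^sup>2)" .
    have 2: "z powi (j - 1) * z = z powi j"
      using z power_int_add[of z "j - 1" 1] by simp
    have "h (j - 1) * (z * q * (q\<^sup>2) ^ m) = qbinom_coeff (q\<^sup>2) m n (j - 1) *
        ((q powi ((j - 1)\<^sup>2) * (q * (q\<^sup>2) ^ m)) * (z powi (j - 1) * z))"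
      by (simp add: h_def mult_ac)
    also have "\<dots> = (q\<^sup>2) powi (int m + 1 - j) * qbinom_coeff (q\<^sup>2) m n (j - 1) * (q powi (j\<^sup>2) * z powi j)"
      unfolding 1 2 by (simp add: mult_ac)
    finally show ?thesis
      unfolding qbinom_coeff_Suc_left[OF p] by (simp add: h_def algebra_simps)
  qed
  ultimately show ?thesis
    by (simp add: algebra_simps)
qed

lemma finite_triple_product:
  fixes q z :: real
  assumes q: "0 < q" "q < 1" and z: "z \<noteq> 0"
  shows "((\<lambda>j. qbinom_coeff (q\<^sup>2) m n j * (q powi (j\<^sup>2) * z powi j)) has_sum
    ((\<Prod>k<m. 1 + z * q * (q\<^sup>2) ^ k) * (\<Prod>k<n. 1 + q / z * (q\<^sup>2) ^ k))) UNIV"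
proof (induction m)
  case (Suc m)
  from finite_triple_product_Suc[OF q z this] show ?case
    by (simp add: mult_ac)
next
  case 0
  \<comment> \<open>The reflection of \<open>j\<close> to \<open>- j\<close> exchanges
    \<open>z\<close> with \<open>1 / z\<close> and \<open>m\<close> with \<open>n\<close>, so the
    same induction step also builds up the second product.\<close>
  have flip: "((\<lambda>j. qbinom_coeff (q\<^sup>2) n m j * (q powi (j\<^sup>2) * (1 / z) powi j)) has_sum S) UNIV \<longleftrightarrow>
    ((\<lambda>j. qbinom_coeff (q\<^sup>2) m n j * (q powi (j\<^sup>2) * z powi j)) has_sum S) UNIV" for m n S
    by (rule has_sum_reindex_bij_witness[of _ uminus uminus])
      (auto simp: qbinom_coeff_flip[of _ m n] power_int_minus power_int_divide_distrib divide_simps)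
  have "((\<lambda>j. qbinom_coeff (q\<^sup>2) n 0 j * (q powi (j\<^sup>2) * (1 / z) powi j)) has_sum
      (\<Prod>k<n. 1 + q / z * (q\<^sup>2) ^ k)) UNIV"
  proof (induction n)
    case 0
    have "((\<lambda>j. qbinom_coeff (q\<^sup>2) 0 0 j * (q powi (j\<^sup>2) * (1 / z) powi j)) has_sum
      (\<Sum>j\<in>{0}. qbinom_coeff (q\<^sup>2) 0 0 j * (q powi (j\<^sup>2) * (1 / z) powi j))) UNIV"
      by (rule has_sum_finite_neutralI[where B = "{0}"]) (auto simp: qbinom_coeff_def inv_qfact_def)
    then show ?case
      by (simp add: qbinom_coeff_def inv_qfact_def qfact_def)
  next
    case (Suc n)
    from finite_triple_product_Suc[OF q _ this] z show ?case
      by (simp add: mult_ac)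
  qed
  then show ?case
    using flip[of n 0] by simp
qed

text \<open>Take \<open>m = n\<close> in the finite form and let \<open>n\<close> grow. Each
  coefficient tends to \<open>1 / Q\<close>, where \<open>Q\<close> is the limit of
  \<open>qfact p\<close>, and all of them are bounded by \<open>1 / Q^2\<close>, so the assumed
  summability provides the majorant.\<close>

theorem jacobi_triple_product:
  fixes q z :: real
  assumes q: "0 < q" "q < 1" and z: "z \<noteq> 0"
    and summ: "(\<lambda>j. q powi (j\<^sup>2) * \<bar>z\<bar> powi j) summable_on UNIV"
  shows "(\<Sum>\<^sub>\<infinity>j. q powi (j\<^sup>2) * z powi j) =
    qpoch_inf (q\<^sup>2) (q\<^sup>2) * qpoch_inf (- (z * q)) (q\<^sup>2) * qpoch_inf (- (q / z)) (q\<^sup>2)"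
proof -
  define p where "p = q\<^sup>2"
  have p: "0 < p" "p < 1" "0 \<le> p"
    using q by (auto simp: abs_square_less_1 p_def)
  define Q where "Q = qpoch_inf p p"
  have Q: "Q > 0"
    unfolding Q_def using p by (intro qpoch_inf_pos) auto
  have lim: "(\<lambda>n. qfact p n) \<longlonglongrightarrow> Q"
    unfolding qfact_def Q_def using p by (intro qpoch_inf_LIMSEQ) auto
  have "decseq (qfact p)"
  proof (rule decseq_SucI)
    fix n
    have "qfact p (Suc n) = qfact p n * (1 - p * p ^ n)"
      by (simp add: qfact_def)
    also have "\<dots> \<le> qfact p n * 1"
      using p qfact_pos[of p n] by (intro mult_left_mono) (auto simp: less_imp_le)
    finally show "qfact p (Suc n) \<le> qfact p n" by simp
  qed
  then have Q_le: "Q \<le> qfact p n" for n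
    using lim decseq_ge by blast
  have le_1: "qfact p n \<le> 1" for n
    using \<open>decseq (qfact p)\<close> decseqD[of "qfact p" 0 n] by (simp add: qfact_def)
  have inv_le: "0 \<le> inv_qfact p k" "inv_qfact p k \<le> 1 / Q" for k
    using Q Q_le[of "nat k"] by (auto simp: inv_qfact_def divide_simps)
  have coeff_le: "\<bar>qbinom_coeff p n n j\<bar> \<le> 1 / Q * (1 / Q)" for n j
  proof -
    have "\<bar>qbinom_coeff p n n j\<bar> = qfact p (n + n) * (inv_qfact p (int n - j) * inv_qfact p (int n + j))"
      using inv_le qfact_pos[of p "n + n"] p by (simp add: qbinom_coeff_def abs_mult)
    also have "\<dots> \<le> 1 * (1 / Q * (1 / Q))"
      using inv_le qfact_pos[of p "n + n"] p le_1 Q by (intro mult_mono) auto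
    finally show ?thesis by simp
  qed
  have lim_inv: "(\<lambda>n. inv_qfact p (int n + j)) \<longlonglongrightarrow> 1 / Q" for j
  proof -
    have "filterlim (\<lambda>n. nat (int n + j)) sequentially sequentially"
      unfolding filterlim_at_top
    proof
      fix Z
      show "\<forall>\<^sub>F n in sequentially. Z \<le> nat (int n + j)"
        using eventually_ge_at_top[of "Z + nat (- j)"] by eventually_elim linarith
    qed
    then have "(\<lambda>n. 1 / qfact p (nat (int n + j))) \<longlonglongrightarrow> 1 / Q"
      using Q by (intro tendsto_divide tendsto_const filterlim_compose[OF lim]) auto
    moreover have "\<forall>\<^sub>F n in sequentially. 1 / qfact p (nat (int n + j)) = inv_qfact p (int n + j)"
      using eventually_ge_at_top[of "nat (- j)"] by eventually_elim (auto simp: inv_qfact_def)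
    ultimately show ?thesis
      by (rule Lim_transform_eventually)
  qed
  have "(\<lambda>n. qfact p (n + n)) \<longlonglongrightarrow> Q"
    using LIMSEQ_subseq_LIMSEQ[OF lim, of "\<lambda>n. n + n"] by (simp add: o_def strict_mono_def)
  then have lim_coeff: "(\<lambda>n. qbinom_coeff p n n j) \<longlonglongrightarrow> Q * (1 / Q) * (1 / Q)" for j
    unfolding qbinom_coeff_def using lim_inv[of "- j"] lim_inv[of j] by (intro tendsto_mult) auto
  have "(\<lambda>n. \<Sum>\<^sub>\<infinity>j. qbinom_coeff p n n j * (q powi (j\<^sup>2) * z powi j)) \<longlonglongrightarrow>
        (\<Sum>\<^sub>\<infinity>j. 1 / Q * (q powi (j\<^sup>2) * z powi j))"
  proof (rule tendsto_infsum_int_dominated)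
    show "(\<lambda>n. qbinom_coeff p n n j * (q powi (j\<^sup>2) * z powi j)) \<longlonglongrightarrow> 1 / Q * (q powi (j\<^sup>2) * z powi j)" for j
      using tendsto_mult[OF lim_coeff[of j] tendsto_const] Q by simp
    show "\<forall>\<^sub>F n in sequentially. \<forall>j. \<bar>qbinom_coeff p n n j * (q powi (j\<^sup>2) * z powi j)\<bar>
        \<le> 1 / Q * (1 / Q) * (q powi (j\<^sup>2) * \<bar>z\<bar> powi j)"
    proof (intro always_eventually allI)
      fix n j
      have "\<bar>qbinom_coeff p n n j * (q powi (j\<^sup>2) * z powi j)\<bar> = 
          \<bar>qbinom_coeff p n n j\<bar> * (q powi (j\<^sup>2) * \<bar>z\<bar> powi j)"
        using q by (simp add: abs_mult power_int_abs)
      also have "\<dots> \<le> 1 / Q * (1 / Q) * (q powi (j\<^sup>2) * \<bar>z\<bar> powi j)"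
        using q by (intro mult_right_mono coeff_le) auto
      finally show "\<bar>qbinom_coeff p n n j * (q powi (j\<^sup>2) * z powi j)\<bar>
        \<le> 1 / Q * (1 / Q) * (q powi (j\<^sup>2) * \<bar>z\<bar> powi j)" .
    qed
    show "(\<lambda>j. 1 / Q * (1 / Q) * (q powi (j\<^sup>2) * \<bar>z\<bar> powi j)) summable_on UNIV"
      by (intro summable_on_cmult_right summ)
  qed
  then have "(\<lambda>n. (\<Prod>k<n. 1 + z * q * p ^ k) * (\<Prod>k<n. 1 + q / z * p ^ k)) \<longlonglongrightarrow>
        1 / Q * (\<Sum>\<^sub>\<infinity>j. (q powi (j\<^sup>2) * z powi j))"
    using infsumI[OF finite_triple_product[OF q z]] unfolding p_def infsum_cmult_right' by simp
  moreover have "(\<lambda>n. (\<Prod>k<n. 1 - (- (z * q)) * p ^ k) * (\<Prod>k<n. 1 - (- (q / z)) * p ^ k)) \<longlonglongrightarrow>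
      qpoch_inf (- (z * q)) p * qpoch_inf (- (q / z)) p"
    using p by (intro tendsto_mult qpoch_inf_LIMSEQ) auto
  ultimately have "1 / Q * (\<Sum>\<^sub>\<infinity>j. (q powi (j\<^sup>2) * z powi j)) = qpoch_inf (- (z * q)) p * qpoch_inf (- (q / z)) p"
    using LIMSEQ_unique by simp
  then have "(\<Sum>\<^sub>\<infinity>j. q powi (j\<^sup>2) * z powi j) = Q * qpoch_inf (- (z * q)) p * qpoch_inf (- (q / z)) p"
    using Q by (simp add: field_simps)
  then show ?thesis
    by (simp add: p_def Q_def)
qed

section \<open>Theta series\<close>

lemma summable_on_int_geometric:
  fixes r :: real
  assumes "0 \<le> r" "r < 1"
  shows "(\<lambda>k::int. r ^ nat \<bar>k\<bar>) summable_on UNIV"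
proof -
  have r: "(\<lambda>n::nat. r ^ n) summable_on UNIV"
    using assms by (intro norm_summable_imp_summable_on) (auto intro!: summable_geometric)
  have 1: "(\<lambda>k::int. r ^ nat \<bar>k\<bar>) summable_on range int"
    by (subst summable_on_reindex) (use r in \<open>auto simp: o_def\<close>)
  have 2: "(\<lambda>k::int. r ^ nat \<bar>k\<bar>) summable_on range (\<lambda>n. - int n)"
    by (subst summable_on_reindex) (use r in \<open>auto simp: o_def inj_on_def\<close>)
  have "range int \<union> range (\<lambda>n. - int n) = UNIV"
    by (metis (no_types, lifting) UNIV_eq_I UnI1 UnI2 int_cases2 rangeI)
  then show ?thesis
    using summable_on_union[OF 1 2] by simp
qed

text \<open>For such \<open>c\<close> one has \<open>(k + c)^2 \<ge> \<bar>k\<bar> - 1\<close>, a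
  consequence of \<open>(\<bar>k\<bar> - 1)^2 \<ge> 0\<close>, which gives a geometric
  majorant.\<close>

lemma summable_on_gaussian:
  fixes s c :: real
  assumes s: "s > 0" and c: "\<bar>c\<bar> \<le> 1 / 2"
  shows "(\<lambda>k::int. exp (- s * (of_int k + c)\<^sup>2)) summable_on (UNIV :: int set)"
proof -
  have "(\<lambda>k::int. exp s * exp (- s) ^ nat \<bar>k\<bar>) summable_on UNIV"
    using summable_on_cmult_right[OF summable_on_int_geometric[of "exp (- s)"], of "exp s"] s by simp
  moreover have "norm (exp (- s * (of_int k + c)\<^sup>2)) \<le> exp s * exp (- s) ^ nat \<bar>k\<bar>" for k :: int
  proof -
    have "\<bar>of_int k * c\<bar> \<le> \<bar>of_int k\<bar> * (1 / 2)"
      unfolding abs_mult using c by (intro mult_left_mono) auto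
    moreover have "(\<bar>of_int k\<bar> - 1)\<^sup>2 = (of_int k)\<^sup>2 - 2 * \<bar>of_int k\<bar> + (1::real)"
      by (simp add: power2_diff)
    moreover have "(of_int k + c)\<^sup>2 = (of_int k)\<^sup>2 + c\<^sup>2 + 2 * (of_int k * c)"
      by (simp add: power2_sum)
    moreover have "(\<bar>of_int k\<bar> - 1)\<^sup>2 \<ge> (0::real)" "c\<^sup>2 \<ge> 0"
      by auto
    ultimately have "\<bar>of_int k\<bar> - 1 \<le> (of_int k + c)\<^sup>2"
      by linarith
    then have "s * (\<bar>of_int k\<bar> - 1) \<le> s * (of_int k + c)\<^sup>2"
      using s by (intro mult_left_mono) auto
    then have "exp (- s * (of_int k + c)\<^sup>2) \<le> exp (s + of_nat (nat \<bar>k\<bar>) * (- s))"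
      by (simp add: algebra_simps)
    also have "\<dots> = exp s * exp (- s) ^ nat \<bar>k\<bar>"
      unfolding exp_add exp_of_nat_mult ..
    finally show ?thesis by simp
  qed
  ultimately show ?thesis
    by (rule abs_summable_summable[OF Infinite_Sum.abs_summable_on_comparison_test'])
qed

text \<open>Jacobi's theta constants at the nome \<open>q = exp (- s)\<close>. In the parameter
  \<open>s\<close>, passing to a power or a root of \<open>q\<close> is a mere rescaling.\<close>

definition theta2 :: "real \<Rightarrow> real" where
  "theta2 s = (\<Sum>\<^sub>\<infinity>k::int. exp (- s * (of_int k + 1 / 2)\<^sup>2))"

definition theta3 :: "real \<Rightarrow> real" where
  "theta3 s = (\<Sum>\<^sub>\<infinity>k::int. exp (- s * (of_int k)\<^sup>2))"

definition theta4 :: "real \<Rightarrow> real" where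
  "theta4 s = (\<Sum>\<^sub>\<infinity>k::int. (if even k then 1 else - 1) * exp (- s * (of_int k)\<^sup>2))"

text \<open>The triple product at \<open>z = 1\<close>, \<open>z = - 1\<close> and
  \<open>z = q\<close>. In the last case \<open>j^2 + j = (j + 1/2)^2 - 1/4\<close> accounts for the
  exponential, and the first factor of \<open>qpoch_inf (- 1) (q^2)\<close> for the 2.\<close>

lemma theta_products:
  assumes s: "s > 0"
  defines "q \<equiv> exp (- s)"
  shows "theta3 s = qpoch_inf (q\<^sup>2) (q\<^sup>2) * (qpoch_inf (- q) (q\<^sup>2))\<^sup>2"
    and "theta4 s = qpoch_inf (q\<^sup>2) (q\<^sup>2) * (qpoch_inf q (q\<^sup>2))\<^sup>2"
    and "theta2 s = 2 * exp (- s / 4) * qpoch_inf (q\<^sup>2) (q\<^sup>2) * (qpoch_inf (- (q\<^sup>2)) (q\<^sup>2))\<^sup>2"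
proof -
  have q: "0 < q" "q < 1"
    using s by (auto simp: q_def)
  have pw: "q powi j = exp (- s * of_int j)" for j
    by (simp add: q_def exp_power_int mult_ac)
  have sq: "q powi (j\<^sup>2) = exp (- s * (of_int j)\<^sup>2)" for j
    unfolding pw by simp
  have summ: "(\<lambda>j::int. q powi (j\<^sup>2)) summable_on UNIV"
    using summable_on_gaussian[OF s, of 0] by (simp add: sq)
  show "theta3 s = qpoch_inf (q\<^sup>2) (q\<^sup>2) * (qpoch_inf (- q) (q\<^sup>2))\<^sup>2"
    using jacobi_triple_product[OF q, of 1] summ
    by (simp add: theta3_def sq power2_eq_square[of "qpoch_inf a b" for a b] mult.assoc)
  have "(- 1) powi j = (if even j then 1 else - 1 :: real)" for j
    by (simp add: power_int_minus_left)
  then show "theta4 s = qpoch_inf (q\<^sup>2) (q\<^sup>2) * (qpoch_inf q (q\<^sup>2))\<^sup>2"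
    using jacobi_triple_product[OF q, of "- 1"] summ
    by (simp add: theta4_def sq power2_eq_square[of "qpoch_inf a b" for a b] mult.assoc mult.commute)
  have shift: "q powi (j\<^sup>2) * q powi j = exp (s / 4) * exp (- s * (of_int j + 1 / 2)\<^sup>2)" for j
    unfolding sq pw exp_add[symmetric] by (simp add: power2_eq_square algebra_simps)
  have "(\<lambda>j. q powi (j\<^sup>2) * \<bar>q\<bar> powi j) summable_on UNIV"
    using q summable_on_cmult_right[OF summable_on_gaussian[OF s, of "1 / 2"], of "exp (s / 4)"]
    by (simp add: shift)
  then have "exp (s / 4) * theta2 s =
      qpoch_inf (q\<^sup>2) (q\<^sup>2) * qpoch_inf (- (q\<^sup>2)) (q\<^sup>2) * qpoch_inf (- 1) (q\<^sup>2)"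
    using jacobi_triple_product[OF q, of q] q
    by (simp add: shift infsum_cmult_right' theta2_def flip: power2_eq_square)
  also have "qpoch_inf (- 1) (q\<^sup>2) = 2 * qpoch_inf (- (q\<^sup>2)) (q\<^sup>2)"
    using q qpoch_inf_split_first[of "q\<^sup>2" "- 1"] by (simp add: abs_square_less_1)
  finally have "exp (- s / 4) * (exp (s / 4) * theta2 s) =
      2 * exp (- s / 4) * qpoch_inf (q\<^sup>2) (q\<^sup>2) * (qpoch_inf (- (q\<^sup>2)) (q\<^sup>2))\<^sup>2"
    by (simp add: power2_eq_square)
  then show "theta2 s = 2 * exp (- s / 4) * qpoch_inf (q\<^sup>2) (q\<^sup>2) * (qpoch_inf (- (q\<^sup>2)) (q\<^sup>2))\<^sup>2"
    unfolding mult.assoc[symmetric] exp_add[symmetric] by simp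
qed

section \<open>Theta identities from double series\<close>

lemma has_sum_product:
  fixes f g :: "'a \<Rightarrow> real"
  assumes f: "f summable_on A" and g: "g summable_on B"
  shows "((\<lambda>(x, y). f x * g y) has_sum (infsum f A * infsum g B)) (A \<times> B)"
proof -
  have f': "(\<lambda>x. norm (f x)) summable_on A" and g': "(\<lambda>x. norm (g x)) summable_on B"
    using assms summable_on_iff_abs_summable_on_real by auto
  have "(\<lambda>p. norm (case p of (x, y) \<Rightarrow> f x * g y)) summable_on A \<times> B"
    unfolding Infinite_Sum.abs_summable_on_Sigma_iff
    using f' g' by (auto simp: abs_mult infsum_cmult_right' intro!: summable_on_cmult_right summable_on_cmult_left)
  then have s: "(\<lambda>(x, y). f x * g y) summable_on A \<times> B"
    by (rule abs_summable_summable)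
  have "infsum (\<lambda>(x, y). f x * g y) (A \<times> B) = infsum f A * infsum g B"
    using infsum_Sigma'_banach[of "\<lambda>x y. f x * g y" A "\<lambda>_. B"] s
    by (simp add: infsum_cmult_right' infsum_cmult_left')
  then show ?thesis
    using s by (simp add: has_sum_iff)
qed

text \<open>The pairs of integers with even sum form an index-two sublattice; splitting a double
  theta series along it is the source of all theta identities below.\<close>

definition even_pairs :: "(int \<times> int) set" where
  "even_pairs = {(m, n). even (m + n)}"

text \<open>Reduces bijectivity of an affine change of variables to two statements that Presburger
  arithmetic decides.\<close>

lemma bij_betw_int_pairs:
  fixes g h :: "int \<Rightarrow> int \<Rightarrow> int"
  assumes range: "\<And>m n. (m, n) \<in> S \<longleftrightarrow> (\<exists>a b. m = g a b \<and> n = h a b)"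
    and inj: "\<And>a b c d. g a b = g c d \<and> h a b = h c d \<Longrightarrow> a = c \<and> b = d" 
  shows "bij_betw (\<lambda>(a, b). (g a b, h a b)) UNIV S"
proof (rule bij_betw_imageI)
  show "inj (\<lambda>(a, b). (g a b, h a b))"
  proof (rule injI)
    fix x y assume "(case x of (a, b) \<Rightarrow> (g a b, h a b)) = (case y of (a, b) \<Rightarrow> (g a b, h a b))"
    then show "x = y"
      using inj[of "fst x" "snd x" "fst y" "snd y"] by (simp add: case_prod_unfold prod_eq_iff)
  qed
  show "range (\<lambda>(a, b). (g a b, h a b)) = S"
    unfolding set_eq_iff image_iff by (simp add: range split_paired_All)
qed
text \<open>The first three maps are rotations by 45 degrees with scaling, under which
  \<open>m^2 + n^2\<close> becomes \<open>2 A^2 + 2 B^2\<close>; the offsets create or absorb the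
  shifts by one half. The fourth map serves the form \<open>m^2 + 3 n^2\<close>.\<close>

lemma bij_even_pairs: "bij_betw (\<lambda>(a, b). (a + b, a - b)) UNIV even_pairs"
  and bij_odd_pairs: "bij_betw (\<lambda>(a, b). (a + b + 1, a - b)) UNIV (- even_pairs)"
  and bij_odd_pairs': "bij_betw (\<lambda>(a, b). (a + b, a - b - 1)) UNIV (- even_pairs)"
  and bij_odd_pairs_cubic: "bij_betw (\<lambda>(a, b). (2 * a - b + 1, - b)) UNIV (- even_pairs)"
proof -
  have E: "(m, n) \<in> even_pairs \<longleftrightarrow> even (m + n)" for m n
    by (simp add: even_pairs_def)
  show "bij_betw (\<lambda>(a, b). (a + b, a - b)) UNIV even_pairs"
  proof (rule bij_betw_int_pairs)
    show "(m, n) \<in> even_pairs \<longleftrightarrow> (\<exists>a b. m = a + b \<and> n = a - b)" for m n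
      unfolding E by presburger
  qed presburger
  show "bij_betw (\<lambda>(a, b). (a + b + 1, a - b)) UNIV (- even_pairs)"
  proof (rule bij_betw_int_pairs)
    show "(m, n) \<in> - even_pairs \<longleftrightarrow> (\<exists>a b. m = a + b + 1 \<and> n = a - b)" for m n
      unfolding Compl_iff E by presburger
  qed presburger
  show "bij_betw (\<lambda>(a, b). (a + b, a - b - 1)) UNIV (- even_pairs)"
  proof (rule bij_betw_int_pairs)
    show "(m, n) \<in> - even_pairs \<longleftrightarrow> (\<exists>a b. m = a + b \<and> n = a - b - 1)" for m n
      unfolding Compl_iff E by presburger
  qed presburger
  show "bij_betw (\<lambda>(a, b). (2 * a - b + 1, - b)) UNIV (- even_pairs)"
  proof (rule bij_betw_int_pairs)
    show "(m, n) \<in> - even_pairs \<longleftrightarrow> (\<exists>a b. m = 2 * a - b + 1 \<and> n = - b)" for m n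
      unfolding Compl_iff E by presburger
  qed presburger
qed

lemma has_sum_split_even_pairs:
  fixes f :: "int \<times> int \<Rightarrow> real"
  assumes "(f has_sum S) UNIV"
  shows "S = infsum f even_pairs + infsum f (- even_pairs)"
proof -
  have 1: "f summable_on even_pairs" "f summable_on (- even_pairs)"
    using assms by (meson has_sum_imp_summable summable_on_subset_banach top_greatest)+
  show "S = infsum f even_pairs + infsum f (- even_pairs)"
    using infsum_Un_disjoint[OF 1] infsumI[OF assms] by simp
qed

lemma theta_product_has_sum:
  fixes s t c d :: real
  assumes "s > 0" "t > 0" "\<bar>c\<bar> \<le> 1 / 2" "\<bar>d\<bar> \<le> 1 / 2"
  shows "((\<lambda>(m, n). exp (- s * (of_int m + c)\<^sup>2 - t * (of_int n + d)\<^sup>2)) has_sum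
    ((\<Sum>\<^sub>\<infinity>k::int. exp (- s * (of_int k + c)\<^sup>2)) * (\<Sum>\<^sub>\<infinity>k::int. exp (- t * (of_int k + d)\<^sup>2)))) UNIV"
proof -
  have "exp (- s * (of_int m + c)\<^sup>2 - t * (of_int n + d)\<^sup>2) =
      exp (- s * (of_int m + c)\<^sup>2) * exp (- t * (of_int n + d)\<^sup>2)" for m n :: int
    by (simp add: exp_diff exp_minus field_simps)
  then show ?thesis
    using has_sum_product[OF summable_on_gaussian summable_on_gaussian, of s c t d] assms by simp
qed

lemma theta4_product_has_sum:
  assumes "s > 0" "t > 0"
  shows "((\<lambda>(m, n). (if (m, n) \<in> even_pairs then 1 else - 1) *
    exp (- s * (of_int m)\<^sup>2 - t * (of_int n)\<^sup>2)) has_sum (theta4 s * theta4 t)) UNIV"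
proof -
  let ?e = "\<lambda>k::int. if even k then 1 else - 1 :: real"
  have summ: "(\<lambda>k::int. ?e k * exp (- s * (of_int k)\<^sup>2)) summable_on UNIV" if "s > 0" for s
  proof (rule abs_summable_summable, rule Infinite_Sum.abs_summable_on_comparison_test')
    show "(\<lambda>k::int. exp (- s * (of_int k)\<^sup>2)) summable_on UNIV"
      using summable_on_gaussian[OF that, of 0] by simp
  qed auto
  have "(if (m, n) \<in> even_pairs then 1 else - 1) * exp (- s * (of_int m)\<^sup>2 - t * (of_int n)\<^sup>2) =
      (?e m * exp (- s * (of_int m)\<^sup>2)) * (?e n * exp (- t * (of_int n)\<^sup>2))" for m n :: int
    by (simp add: exp_diff exp_minus field_simps even_pairs_def)
  then show ?thesis
    using has_sum_product[OF summ summ, of s t] assms by (simp add: theta4_def)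
qed

text \<open>The two alternating signs multiply to the parity of \<open>m + n\<close>, so both
  products are built from the same two partial sums.\<close>

lemma theta3_theta4_even_pairs:
  fixes s t :: real
  assumes "s > 0" "t > 0"
  defines "f \<equiv> \<lambda>(m::int, n::int). exp (- s * (of_int m)\<^sup>2 - t * (of_int n)\<^sup>2)"
  shows "theta3 s * theta3 t = infsum f even_pairs + infsum f (- even_pairs)"
    and "theta4 s * theta4 t = infsum f even_pairs - infsum f (- even_pairs)"
proof -
  show "theta3 s * theta3 t = infsum f even_pairs + infsum f (- even_pairs)"
    using has_sum_split_even_pairs[OF theta_product_has_sum[of s t 0 0]] assms
    by (simp add: theta3_def f_def)
  have "theta4 s * theta4 t = infsum (\<lambda>(m, n). (if (m, n) \<in> even_pairs then 1 else - 1) * f (m, n)) even_pairs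
     + infsum (\<lambda>(m, n). (if (m, n) \<in> even_pairs then 1 else - 1) * f (m, n)) (- even_pairs)"
    using has_sum_split_even_pairs[OF theta4_product_has_sum[of s t]] assms by (simp add: f_def)
  also have "infsum (\<lambda>(m, n). (if (m, n) \<in> even_pairs then 1 else - 1) * f (m, n)) even_pairs = infsum f even_pairs"
    by (rule infsum_cong) auto
  also have "infsum (\<lambda>(m, n). (if (m, n) \<in> even_pairs then 1 else - 1) * f (m, n)) (- even_pairs) =
      infsum (\<lambda>x. - f x) (- even_pairs)"
    by (rule infsum_cong) auto
  finally show "theta4 s * theta4 t = infsum f even_pairs - infsum f (- even_pairs)"
    by (simp add: infsum_uminus)
qed

text \<open>The rotation turns the even part of the integer lattice into
  \<open>theta3 (2 * s)\<close> squared and the odd part into \<open>theta2 (2 * s)\<close> squared.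
  On the half-integer lattice each part becomes the mixed product, hence the factor 2.\<close>

lemma theta_duplication:
  assumes s: "s > 0"
  shows "(theta3 s)\<^sup>2 + (theta4 s)\<^sup>2 = 2 * (theta3 (2 * s))\<^sup>2"
    and "(theta3 s)\<^sup>2 - (theta4 s)\<^sup>2 = 2 * (theta2 (2 * s))\<^sup>2"
    and "(theta2 s)\<^sup>2 = 2 * theta2 (2 * s) * theta3 (2 * s)"
proof -
  define f where "f = (\<lambda>(m::int, n::int). exp (- s * (of_int m)\<^sup>2 - s * (of_int n)\<^sup>2))"
  define h where "h = (\<lambda>(m::int, n::int). exp (- s * (of_int m + 1 / 2)\<^sup>2 - s * (of_int n + 1 / 2)\<^sup>2))"
  have s2: "2 * s > 0" using s by simp
  have "infsum f even_pairs =
      infsum (\<lambda>(a, b). exp (- (2 * s) * (of_int a)\<^sup>2 - (2 * s) * (of_int b)\<^sup>2)) UNIV"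
    using infsum_reindex_bij_betw[OF bij_even_pairs, of f]
    by (simp add: f_def case_prod_unfold power2_eq_square algebra_simps)
  also have "\<dots> = theta3 (2 * s) * theta3 (2 * s)"
    using infsumI[OF theta_product_has_sum[OF s2 s2, of 0 0]] by (simp add: theta3_def)
  finally have 1: "infsum f even_pairs = (theta3 (2 * s))\<^sup>2"
    by (simp add: power2_eq_square)
  have "infsum f (- even_pairs) =
      infsum (\<lambda>(a, b). exp (- (2 * s) * (of_int a + 1 / 2)\<^sup>2 - (2 * s) * (of_int b + 1 / 2)\<^sup>2)) UNIV"
    using infsum_reindex_bij_betw[OF bij_odd_pairs, of f]
    by (simp add: f_def case_prod_unfold power2_eq_square algebra_simps)
  also have "\<dots> = theta2 (2 * s) * theta2 (2 * s)"
    using infsumI[OF theta_product_has_sum[OF s2 s2, of "1 / 2" "1 / 2"]] by (simp add: theta2_def)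
  finally have 2: "infsum f (- even_pairs) = (theta2 (2 * s))\<^sup>2"
    by (simp add: power2_eq_square)
  note split = theta3_theta4_even_pairs[OF s s, folded f_def]
  show "(theta3 s)\<^sup>2 + (theta4 s)\<^sup>2 = 2 * (theta3 (2 * s))\<^sup>2"
    "(theta3 s)\<^sup>2 - (theta4 s)\<^sup>2 = 2 * (theta2 (2 * s))\<^sup>2"
    using split 1 2 by (simp_all add: power2_eq_square)
  have "infsum h even_pairs =
      infsum (\<lambda>(a, b). exp (- (2 * s) * (of_int a + 1 / 2)\<^sup>2 - (2 * s) * (of_int b)\<^sup>2)) UNIV"
    using infsum_reindex_bij_betw[OF bij_even_pairs, of h]
    by (simp add: h_def case_prod_unfold power2_eq_square algebra_simps)
  moreover have "infsum h (- even_pairs) =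
      infsum (\<lambda>(a, b). exp (- (2 * s) * (of_int a)\<^sup>2 - (2 * s) * (of_int b + 1 / 2)\<^sup>2)) UNIV"
    unfolding infsum_reindex_bij_betw[OF bij_odd_pairs', of h, symmetric]
    by (rule infsum_cong) (auto simp: h_def power2_eq_square algebra_simps)
  moreover have "infsum (\<lambda>(a::int, b::int). exp (- (2 * s) * (of_int a + 1 / 2)\<^sup>2 - (2 * s) * (of_int b)\<^sup>2)) UNIV
      = theta2 (2 * s) * theta3 (2 * s)"
    using infsumI[OF theta_product_has_sum[OF s2 s2, of "1 / 2" 0]] by (simp add: theta2_def theta3_def)
  moreover have "infsum (\<lambda>(a::int, b::int). exp (- (2 * s) * (of_int a)\<^sup>2 - (2 * s) * (of_int b + 1 / 2)\<^sup>2)) UNIV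
      = theta3 (2 * s) * theta2 (2 * s)"
    using infsumI[OF theta_product_has_sum[OF s2 s2, of 0 "1 / 2"]] by (simp add: theta2_def theta3_def)
  moreover have "theta2 s * theta2 s = infsum h even_pairs + infsum h (- even_pairs)"
    using has_sum_split_even_pairs[OF theta_product_has_sum[of s s "1 / 2" "1 / 2"]] s
    by (simp add: theta2_def h_def)
  ultimately show "(theta2 s)\<^sup>2 = 2 * theta2 (2 * s) * theta3 (2 * s)"
    by (simp add: power2_eq_square)
qed

text \<open>The first two duplication formulas multiply to a difference of fourth powers; the third
  identifies the result.\<close>

lemma jacobi_quartic:
  assumes s: "s > 0"
  shows "theta3 s ^ 4 = theta2 s ^ 4 + theta4 s ^ 4"
proof -
  have "theta3 s ^ 4 - theta4 s ^ 4 = ((theta3 s)\<^sup>2 + (theta4 s)\<^sup>2) * ((theta3 s)\<^sup>2 - (theta4 s)\<^sup>2)"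
    by (simp add: power2_eq_square power4_eq_xxxx algebra_simps)
  also have "\<dots> = (2 * theta2 (2 * s) * theta3 (2 * s))\<^sup>2"
    unfolding theta_duplication(1,2)[OF s] by (simp add: power2_eq_square)
  also have "\<dots> = theta2 s ^ 4"
    unfolding theta_duplication(3)[OF s, symmetric] by (simp add: power2_eq_square power4_eq_xxxx)
  finally show ?thesis by simp
qed

text \<open>The substitution on odd pairs is multiplication by the sixth root of unity
  \<open>(1 + sqrt (- 3)) / 2\<close>, an isometry of the form \<open>m\<^sup>2 + 3 n\<^sup>2\<close>.\<close>

lemma theta_cubic:
  assumes s: "s > 0"
  shows "theta3 s * theta3 (3 * s) = theta2 s * theta2 (3 * s) + theta4 s * theta4 (3 * s)"
proof -
  define f where "f = (\<lambda>(m::int, n::int). exp (- s * (of_int m)\<^sup>2 - (3 * s) * (of_int n)\<^sup>2))"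
  define h where "h = (\<lambda>(m::int, n::int). exp (- s * (of_int m + 1 / 2)\<^sup>2 - (3 * s) * (of_int n + 1 / 2)\<^sup>2))"
  have s3: "3 * s > 0" using s by simp
  \<comment> \<open>In the coordinates \<open>(a, b)\<close> both exponents become
    \<open>- s\<close> times \<open>4 A^2 - 4 A b + 4 b^2\<close> with
    \<open>A = a + 1/2\<close>.\<close>
  have 1: "infsum f (- even_pairs) = infsum h even_pairs"
    using infsum_reindex_bij_betw[OF bij_odd_pairs_cubic, of f] infsum_reindex_bij_betw[OF bij_even_pairs, of h]
    by (simp add: f_def h_def case_prod_unfold power2_eq_square algebra_simps)
  \<comment> \<open>Negating \<open>m + 1/2\<close> preserves \<open>h\<close> and flips the parity
    of \<open>m + n\<close>.\<close>
  have 2: "infsum h even_pairs = infsum h (- even_pairs)"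
    by (rule infsum_reindex_bij_witness[of _ "\<lambda>(m, n). (- 1 - m, n)" "\<lambda>(m, n). (- 1 - m, n)"])
      (auto simp: even_pairs_def h_def power2_eq_square algebra_simps)
  have "theta2 s * theta2 (3 * s) = infsum h even_pairs + infsum h (- even_pairs)"
    using has_sum_split_even_pairs[OF theta_product_has_sum[OF s s3, of "1 / 2" "1 / 2"]]
    by (simp add: theta2_def h_def)
  then show ?thesis
    using theta3_theta4_even_pairs[OF s s3, folded f_def] 1 2 by simp
qed

section \<open>The theta transformation at its fixed point\<close>

text \<open>Orthogonality of the characters modulo \<open>n\<close>, with a shift. When
  \<open>n\<close> does not divide \<open>r\<close>, multiplication by
  \<open>2 * sin \<alpha>\<close> makes the sum over a full period telescope to zero.\<close>

lemma sum_cos_progression: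
  fixes r l :: int and n :: nat and \<sigma> :: real
  assumes n: "n > 0"
  shows "(\<Sum>j<n. cos (2 * pi * of_int r * (of_nat j + \<sigma>) / of_nat n)) =
    (if int n dvd r then of_nat n * cos (2 * pi * \<sigma> * of_int (r div int n)) else 0)"
proof (cases "int n dvd r")
  case True
  then obtain t where r: "r = int n * t" by auto
  have "cos (2 * pi * of_int r * (of_nat j + \<sigma>) / of_nat n) = cos (2 * pi * \<sigma> * of_int t)" for j
  proof -
    have "2 * pi * of_int r * (of_nat j + \<sigma>) / of_nat n = 2 * pi * \<sigma> * of_int t + 2 * pi * of_int (t * int j)"
      using n by (simp add: r field_simps)
    then show ?thesis
      using sin_int_2pin[of "t * int j"] cos_int_2pin[of "t * int j"] by (simp add: cos_add)
  qed
  then show ?thesis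
    using True n by (simp add: r)
next
  case False
  define \<alpha> where "\<alpha> = pi * of_int r / of_nat n"
  have "sin \<alpha> \<noteq> 0"
  proof
    assume "sin \<alpha> = 0"
    then obtain i :: int where "pi * of_int r / of_nat n = of_int i * pi"
      unfolding sin_zero_iff_int2 \<alpha>_def by blast
    then have "of_int r = (of_int (int n * i) :: real)"
      using n by (simp add: field_simps)
    then have "r = int n * i"
      unfolding of_int_eq_iff .
    then show False using False by simp
  qed
  \<comment> \<open>The offset one half places consecutive values of \<open>g\<close> at angles
    \<open>\<alpha>\<close> before and after that of the cosine, so their difference is the product
    \<open>2 sin cos\<close>.\<close>
  define g where "g = (\<lambda>j::nat. sin (2 * \<alpha> * (of_nat j + \<sigma> - 1 / 2)))"
  have "2 * sin \<alpha> * (\<Sum>j<n. cos (2 * pi * of_int r * (of_nat j + \<sigma>) / of_nat n)) =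
      (\<Sum>j<n. g (Suc j) - g j)"
    unfolding sum_distrib_left
  proof (rule sum.cong[OF refl])
    fix j
    have 1: "2 * pi * of_int r * (of_nat j + \<sigma>) / of_nat n = 2 * \<alpha> * (of_nat j + \<sigma>)"
      by (simp add: \<alpha>_def)
    have 2: "g (Suc j) = sin (2 * \<alpha> * (of_nat j + \<sigma>) + \<alpha>)" "g j = sin (2 * \<alpha> * (of_nat j + \<sigma>) - \<alpha>)"
      by (simp_all add: g_def algebra_simps)
    show "2 * sin \<alpha> * cos (2 * pi * of_int r * (of_nat j + \<sigma>) / of_nat n) = g (Suc j) - g j"
      unfolding 1 2 sin_add sin_diff by simp
  qed
  also have "\<dots> = g n - g 0"
    by (rule sum_lessThan_telescope)
  also have "g n = g 0"
  proof -
    have "2 * \<alpha> * (of_nat n + \<sigma> - 1 / 2) = 2 * \<alpha> * (\<sigma> - 1 / 2) + 2 * pi * of_int r"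
      using n by (simp add: \<alpha>_def field_simps)
    then show ?thesis
      unfolding g_def using sin_int_2pin[of r] cos_int_2pin[of r] by (simp only: sin_add) simp
  qed
  finally show ?thesis
    using \<open>sin \<alpha> \<noteq> 0\<close> False by simp
qed

text \<open>Binomial expansion of \<open>cis \<theta> + cis (- \<theta>)\<close>, followed by taking
  real parts.\<close>

lemma two_cos_power:
  "(2 * cos \<theta>) ^ (2 * m) = (\<Sum>k\<le>2 * m. real (2 * m choose k) * cos (2 * of_int (int k - int m) * \<theta>))"
proof -
  have "complex_of_real (2 * cos \<theta>) = cis \<theta> + cis (- \<theta>)"
    by (simp add: complex_eq_iff)
  then have "complex_of_real ((2 * cos \<theta>) ^ (2 * m)) = (cis \<theta> + cis (- \<theta>)) ^ (2 * m)"
    by (simp only: of_real_power)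
  also have "\<dots> = (\<Sum>k\<le>2 * m. of_nat (2 * m choose k) * cis \<theta> ^ k * cis (- \<theta>) ^ (2 * m - k))"
    by (rule binomial_ring)
  also have "\<dots> = (\<Sum>k\<le>2 * m. of_real (real (2 * m choose k)) * cis (2 * of_int (int k - int m) * \<theta>))"
  proof (rule sum.cong[OF refl])
    fix k assume "k \<in> {..2 * m}"
    then have "real k * \<theta> + real (2 * m - k) * (- \<theta>) = 2 * of_int (int k - int m) * \<theta>"
      by (simp add: of_nat_diff algebra_simps)
    then show "of_nat (2 * m choose k) * cis \<theta> ^ k * cis (- \<theta>) ^ (2 * m - k) =
        of_real (real (2 * m choose k)) * cis (2 * of_int (int k - int m) * \<theta>)"
      by (simp add: Complex.DeMoivre cis_mult mult.assoc)
  qed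
  finally have "Re (complex_of_real ((2 * cos \<theta>) ^ (2 * m))) =
      Re (\<Sum>k\<le>2 * m. of_real (real (2 * m choose k)) * cis (2 * of_int (int k - int m) * \<theta>))"
    by (rule arg_cong)
  then show ?thesis
    by simp
qed

text \<open>Row \<open>2 m\<close> of Pascal's triangle indexed by the distance from its centre; the
  zeros outside allow sums over all integers.\<close>

definition central_binom :: "nat \<Rightarrow> int \<Rightarrow> real" where
  "central_binom m r = (if \<bar>r\<bar> \<le> int m then real (2 * m choose nat (int m + r)) else 0)"

text \<open>Both sides compute the part of the row \<open>2 m\<close> of Pascal's triangle supported on a residue
  class modulo \<open>n\<close>. As \<open>m\<close> and \<open>n\<close> grow with \<open>n\<^sup>2 / m\<close> tending to \<open>\<pi>\<close>, both become theta series.\<close>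

lemma binomial_sum_residue_class:
  fixes \<sigma> :: real
  assumes n: "n > 0"
  shows "of_nat n * (\<Sum>\<^sub>\<infinity>k::int. cos (2 * pi * \<sigma> * of_int k) * central_binom m (int n * k)) =
    (\<Sum>j<n. (2 * cos (pi * (of_nat j + \<sigma>) / of_nat n)) ^ (2 * m))"
proof -
  define h where "h = (\<lambda>r::int. if int n dvd r then cos (2 * pi * \<sigma> * of_int (r div int n)) else 0)"
  have "(\<Sum>j<n. (2 * cos (pi * (of_nat j + \<sigma>) / of_nat n)) ^ (2 * m)) =
      (\<Sum>j<n. \<Sum>k\<le>2 * m. real (2 * m choose k) * cos (2 * pi * of_int (int k - int m) * (of_nat j + \<sigma>) / of_nat n))"
    by (subst two_cos_power) (simp add: mult_ac)
  also have "\<dots> = (\<Sum>k\<le>2 * m. real (2 * m choose k) *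
      (\<Sum>j<n. cos (2 * pi * of_int (int k - int m) * (of_nat j + \<sigma>) / of_nat n)))"
    unfolding sum_distrib_left by (rule sum.swap)
  also have "\<dots> = of_nat n * (\<Sum>k\<le>2 * m. real (2 * m choose k) * h (int k - int m))"
    unfolding sum_cos_progression[OF n] h_def sum_distrib_left by (intro sum.cong) auto
  also have "(\<Sum>k\<le>2 * m. real (2 * m choose k) * h (int k - int m)) = 
      (\<Sum>r\<in>{- int m..int m}. central_binom m r * h r)"
    by (rule sum.reindex_bij_witness[of _ "\<lambda>r. nat (r + int m)" "\<lambda>k. int k - int m"])
      (auto simp: central_binom_def)
  also have "\<dots> = (\<Sum>\<^sub>\<infinity>r\<in>{- int m..int m}. central_binom m r * h r)"
    by simp
  also have "\<dots> = (\<Sum>\<^sub>\<infinity>r\<in>range ((*) (int n)). central_binom m r * h r)"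
    by (rule infsum_cong_neutral) (auto simp: central_binom_def h_def)
  also have "\<dots> = (\<Sum>\<^sub>\<infinity>k. central_binom m (int n * k) * h (int n * k))"
    using n by (subst infsum_reindex) (auto simp: inj_on_def o_def)
  also have "\<dots> = (\<Sum>\<^sub>\<infinity>k. cos (2 * pi * \<sigma> * of_int k) * central_binom m (int n * k))"
    using n by (simp add: h_def mult.commute)
  finally show ?thesis by simp
qed

text \<open>Moving from distance \<open>i\<close> to \<open>i + 1\<close> multiplies the coefficient
  by \<open>(m - i) / (m + i + 1)\<close>.\<close>

lemma central_binom_ratio:
  assumes "r \<le> m"
  shows "central_binom m (int r) / central_binom m 0 = (\<Prod>i<r. real (m - i) / real (m + i + 1))"
  using assms
proof (induction r)
  case (Suc r)
  have fact: "central_binom m (int r) = fact (2 * m) / (fact (m + r) * fact (m - r))" if "r \<le> m" for r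
  proof -
    have "nat (int m + int r) = m + r" "2 * m - (m + r) = m - r"
      using that by auto
    then show ?thesis
      using that binomial_fact[of "m + r" "2 * m", where ?'a = real] by (simp add: central_binom_def)
  qed
  have "fact (m - r) = real (m - r) * fact (m - Suc r)"
    using Suc.prems fact_reduce[of "m - r", where ?'a = real] by simp
  then have "central_binom m (int (Suc r)) = central_binom m (int r) * (real (m - r) / real (m + r + 1))"
    unfolding fact[OF Suc.prems] fact[OF Suc_leD[OF Suc.prems]] using Suc.prems
    by (simp add: divide_simps del: of_nat_diff of_nat_add)
  then have "central_binom m (int (Suc r)) / central_binom m 0 =
      central_binom m (int r) / central_binom m 0 * (real (m - r) / real (m + r + 1))"
    by (simp only: times_divide_eq_left)
  then show ?case
    unfolding prod.lessThan_Suc using Suc by simp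
qed (auto simp: central_binom_def)

lemma sum_odd_numbers: "(\<Sum>i<r. 2 * real i + 1) = (real r)\<^sup>2"
  by (induction r) (auto simp: power2_eq_square algebra_simps)

text \<open>Each factor is \<open>1 - (2 i + 1) / (m + i + 1)\<close>, hence at most
  \<open>exp (- (2 i + 1) / (m + r))\<close>; the odd numbers add up to \<open>r^2\<close>.\<close>

lemma central_binom_ratio_le:
  assumes "r \<le> m" "m > 0"
  shows "central_binom m (int r) / central_binom m 0 \<le> exp (- ((real r)\<^sup>2 / real (m + r)))"
proof -
  have "(\<Prod>i<r. real (m - i) / real (m + i + 1)) \<le> (\<Prod>i<r. exp (- ((2 * real i + 1) / real (m + r))))"
  proof (rule prod_mono, safe)
    fix i assume i: "i < r"
    have "real (m - i) / real (m + i + 1) = 1 - (2 * real i + 1) / real (m + i + 1)"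
      using i assms by (simp add: of_nat_diff field_simps)
    also have "\<dots> \<le> 1 - (2 * real i + 1) / real (m + r)"
      using i assms by (intro diff_left_mono divide_left_mono) auto
    also have "\<dots> \<le> exp (- ((2 * real i + 1) / real (m + r)))"
      using exp_ge_add_one_self[of "- ((2 * real i + 1) / real (m + r))"] by simp
    finally show "real (m - i) / real (m + i + 1) \<le> exp (- ((2 * real i + 1) / real (m + r)))" .
  qed auto
  also have "\<dots> = exp (- ((real r)\<^sup>2 / real (m + r)))"
    unfolding sum_odd_numbers[symmetric] by (simp add: exp_sum[symmetric] sum_negf sum_divide_distrib)
  finally show ?thesis
    using central_binom_ratio[OF assms(1)] by simp
qed

text \<open>The companion bound comes from the reciprocal factors
  \<open>1 + (2 i + 1) / (m - i)\<close>, each at most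
  \<open>exp ((2 i + 1) / (m - r))\<close>.\<close>

lemma central_binom_ratio_ge:
  assumes "r < m"
  shows "central_binom m (int r) / central_binom m 0 \<ge> exp (- ((real r)\<^sup>2 / real (m - r)))"
proof -
  have "(\<Prod>i<r. exp (- ((2 * real i + 1) / real (m - r)))) \<le> (\<Prod>i<r. real (m - i) / real (m + i + 1))"
  proof (rule prod_mono, safe)
    fix i assume i: "i < r"
    have "real (m + i + 1) / real (m - i) = 1 + (2 * real i + 1) / real (m - i)"
      using i assms by (simp add: of_nat_diff field_simps)
    also have "\<dots> \<le> exp ((2 * real i + 1) / real (m - i))"
      by (rule exp_ge_add_one_self)
    also have "\<dots> \<le> exp ((2 * real i + 1) / real (m - r))"
      using i assms by (subst exp_le_cancel_iff, intro divide_left_mono) auto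
    finally have "inverse (exp ((2 * real i + 1) / real (m - r))) \<le> inverse (real (m + i + 1) / real (m - i))"
      using i assms by (intro le_imp_inverse_le) auto
    then show "exp (- ((2 * real i + 1) / real (m - r))) \<le> real (m - i) / real (m + i + 1)"
      by (simp add: exp_minus)
  qed auto
  also have "(\<Prod>i<r. exp (- ((2 * real i + 1) / real (m - r)))) = exp (- ((real r)\<^sup>2 / real (m - r)))"
    unfolding sum_odd_numbers[symmetric] by (simp add: exp_sum[symmetric] sum_negf sum_divide_distrib)
  finally show ?thesis
    using central_binom_ratio[of r m] assms by simp
qed

lemma central_binom_abs: "central_binom m r = central_binom m (int (nat \<bar>r\<bar>))"
proof (cases "r \<ge> 0 \<or> \<not> \<bar>r\<bar> \<le> int m")
  case False
  then have "nat (int m - r) = 2 * m - nat (int m + r)" "nat (int m + r) \<le> 2 * m"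
    by auto
  then show ?thesis
    using False binomial_symmetric[of "nat (int m + r)" "2 * m"] by (simp add: central_binom_def)
qed (auto simp: central_binom_def)

text \<open>Taylor's formula gives \<open>1 - x^2 / 2 + x^4 / 24\<close>, and
  \<open>x^2 \<le> 4\<close> bounds the last term by \<open>x^2 / 6\<close>. The constant 1/4 is not
  sharp but suffices for a majorant.\<close>

lemma cos_le_gaussian:
  assumes "\<bar>x\<bar> \<le> pi / 2"
  shows "cos x \<le> exp (- (x\<^sup>2 / 4))"
proof -
  have x2: "x\<^sup>2 \<le> 4"
    using assms pi_less_4 abs_le_square_iff[of x 2] by simp
  obtain t where t: "cos x = (\<Sum>m<4. cos_coeff m * x ^ m) + (cos (t + 1 / 2 * real 4 * pi) / fact 4) * x ^ 4"
    using Maclaurin_cos_expansion[of x 4] by blast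
  have "(\<Sum>m<4. cos_coeff m * x ^ m) = 1 - x\<^sup>2 / 2"
    by (simp add: lessThan_nat_numeral cos_coeff_def)
  moreover have "cos (t + 1 / 2 * real 4 * pi) / fact 4 * x ^ 4 \<le> 1 / fact 4 * x ^ 4"
    by (intro mult_right_mono divide_right_mono) auto
  moreover have "1 / fact 4 * x ^ 4 \<le> x\<^sup>2 / 6"
  proof -
    have "x ^ 4 = x\<^sup>2 * x\<^sup>2" by (simp add: power2_eq_square power4_eq_xxxx)
    also have "\<dots> \<le> x\<^sup>2 * 4" using x2 by (intro mult_left_mono) auto
    finally show ?thesis by (simp add: fact_numeral)
  qed
  ultimately have "cos x \<le> 1 + (- (x\<^sup>2 / 4))"
    using t zero_le_power2[of x] by linarith
  also have "\<dots> \<le> exp (- (x\<^sup>2 / 4))"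
    by (rule exp_ge_add_one_self)
  finally show ?thesis .
qed


section \<open>Limits of the binomial sums\<close>

definition polya_modulus :: "nat \<Rightarrow> nat" where
  "polya_modulus n = 2 * Suc n"

text \<open>With modulus \<open>l\<close> and row \<open>m\<close> close to \<open>l^2 / pi\<close>,
  the binomial weights and the cosine powers both tend to Gaussians of parameter \<open>pi\<close>.
  The modulus is even so that its residues can be centred around zero.\<close>

definition polya_row :: "nat \<Rightarrow> nat" where
  "polya_row n = nat \<lfloor>(real (polya_modulus n))\<^sup>2 / pi\<rfloor>"

lemma polya_modulus_at_top: "filterlim (\<lambda>n. real (polya_modulus n)) at_top sequentially"
  unfolding polya_modulus_def by real_asymp

lemma polya_row_bounds:
  shows "polya_row n > 0"
    and "pi * real (polya_row n) \<le> (real (polya_modulus n))\<^sup>2"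
    and "(real (polya_modulus n))\<^sup>2 \<le> 2 * pi * real (polya_row n)"
proof -
  define x where "x = (real (polya_modulus n))\<^sup>2 / pi"
  \<comment> \<open>The least modulus is 2 and \<open>4 / pi > 1\<close>, so the floor is positive
    and loses at most a factor of two.\<close>
  have "(2::real)\<^sup>2 \<le> (real (polya_modulus n))\<^sup>2"
    by (intro power_mono) (auto simp: polya_modulus_def)
  then have x: "x \<ge> 1"
    using pi_less_4 by (simp add: x_def field_simps)
  then have m: "real (polya_row n) = of_int \<lfloor>x\<rfloor>" "\<lfloor>x\<rfloor> \<ge> 1"
    by (auto simp: polya_row_def x_def)
  then have "real (polya_row n) \<ge> 1" "real (polya_row n) \<le> x" "x \<le> 2 * real (polya_row n)"
    by linarith+
  then show "polya_row n > 0" "pi * real (polya_row n) \<le> (real (polya_modulus n))\<^sup>2"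
    "(real (polya_modulus n))\<^sup>2 \<le> 2 * pi * real (polya_row n)"
    by (auto simp: x_def field_simps)
qed

lemma polya_row_limit: "(\<lambda>n. real (polya_row n) / (real (polya_modulus n))\<^sup>2) \<longlonglongrightarrow> 1 / pi"
proof -
  have "(\<lambda>n. of_int \<lfloor>(real (2 * Suc n))\<^sup>2 / pi\<rfloor> / (real (2 * Suc n))\<^sup>2) \<longlonglongrightarrow> inverse pi"
    by real_asymp
  moreover have "real (polya_row n) = of_int \<lfloor>(real (2 * Suc n))\<^sup>2 / pi\<rfloor>" for n
    by (simp add: polya_row_def polya_modulus_def)
  ultimately show ?thesis
    by (simp add: polya_modulus_def inverse_eq_divide)
qed

text \<open>Where the coefficient is nonzero, \<open>m + r \<le> 2 * m\<close>, which costs half of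
  the exponent. The bound is uniform in \<open>n\<close>, as domination requires.\<close>

lemma central_binom_gaussian_bound:
  "\<bar>central_binom (polya_row n) (int (polya_modulus n) * k) / central_binom (polya_row n) 0\<bar>
    \<le> exp (- (pi / 2) * (of_int k)\<^sup>2)"
proof -
  define r where "r = polya_modulus n * nat \<bar>k\<bar>"
  define m where "m = polya_row n"
  have m: "m > 0" "pi * real m \<le> (real (polya_modulus n))\<^sup>2"
    unfolding m_def by (rule polya_row_bounds)+
  have cb: "central_binom m (int (polya_modulus n) * k) = central_binom m (int r)"
    unfolding central_binom_abs[of m "int (polya_modulus n) * k"] r_def by (simp add: abs_mult nat_mult_distrib)
  show ?thesis
  proof (cases "r \<le> m")
    case True
    have "0 \<le> central_binom m (int r) / central_binom m 0"
      by (auto simp: central_binom_def)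
    moreover have "central_binom m (int r) / central_binom m 0 \<le> exp (- ((real r)\<^sup>2 / real (m + r)))"
      by (rule central_binom_ratio_le[OF True m(1)])
    moreover have "pi / 2 * (of_int k)\<^sup>2 \<le> (real r)\<^sup>2 / real (m + r)"
    proof -
      have "pi / 2 * (of_int k)\<^sup>2 * real (m + r) \<le> pi / 2 * (of_int k)\<^sup>2 * (2 * real m)"
        using True by (intro mult_left_mono) auto
      also have "\<dots> = (pi * real m) * (of_int k)\<^sup>2" by simp
      also have "\<dots> \<le> (real (polya_modulus n))\<^sup>2 * (of_int k)\<^sup>2"
        by (intro mult_right_mono m) auto
      also have "\<dots> = (real r)\<^sup>2"
        by (simp add: r_def power_mult_distrib)
      finally show ?thesis
        using m by (simp add: field_simps)
    qed
    ultimately show ?thesis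
      unfolding m_def[symmetric] cb by (smt (verit) exp_le_cancel_iff mult_minus_left)
  next
    case False
    then have "central_binom m (int r) = 0"
      by (simp add: central_binom_def)
    then show ?thesis
      unfolding m_def[symmetric] cb by simp
  qed
qed

text \<open>A squeeze between the two exponential bounds: after division by the squared modulus,
  \<open>m - r\<close> and \<open>m + r\<close> have the same limit \<open>1 / pi\<close>, as
  \<open>r\<close> grows only linearly in the modulus.\<close>

lemma central_binom_gaussian_limit:
  "(\<lambda>n. central_binom (polya_row n) (int (polya_modulus n) * k) / central_binom (polya_row n) 0)
    \<longlonglongrightarrow> exp (- pi * (of_int k)\<^sup>2)"
proof -
  define K where "K = nat \<bar>k\<bar>"
  define r where "r = (\<lambda>n. polya_modulus n * K)"
  let ?l = "\<lambda>n. real (polya_modulus n)" and ?m = "\<lambda>n. real (polya_row n)"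
  have cb: "central_binom m (int (polya_modulus n) * k) = central_binom m (int (r n))" for n m
    unfolding central_binom_abs[of m "int (polya_modulus n) * k"] r_def K_def by (simp add: abs_mult nat_mult_distrib)
  have l_pos: "?l n > 0" for n
    by (simp add: polya_modulus_def)
  have K0: "(\<lambda>n. real K / ?l n) \<longlonglongrightarrow> 0"
    by (rule real_tendsto_divide_at_top[OF tendsto_const polya_modulus_at_top])
  have minus: "(\<lambda>n. ?m n / (?l n)\<^sup>2 - real K / ?l n) \<longlonglongrightarrow> 1 / pi"
    and plus: "(\<lambda>n. ?m n / (?l n)\<^sup>2 + real K / ?l n) \<longlonglongrightarrow> 1 / pi"
    using tendsto_diff[OF polya_row_limit K0] tendsto_add[OF polya_row_limit K0] by simp_all
  have scale: "(real (r n))\<^sup>2 / (?m n - real (r n)) = (real K)\<^sup>2 / (?m n / (?l n)\<^sup>2 - real K / ?l n)"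
    "(real (r n))\<^sup>2 / (?m n + real (r n)) = (real K)\<^sup>2 / (?m n / (?l n)\<^sup>2 + real K / ?l n)" for n
  proof -
    have "?m n / (?l n)\<^sup>2 - real K / ?l n = (?m n - real (r n)) / (?l n)\<^sup>2"
      "?m n / (?l n)\<^sup>2 + real K / ?l n = (?m n + real (r n)) / (?l n)\<^sup>2"
      using l_pos[of n] by (simp_all add: r_def field_simps power2_eq_square)
    then show "(real (r n))\<^sup>2 / (?m n - real (r n)) = (real K)\<^sup>2 / (?m n / (?l n)\<^sup>2 - real K / ?l n)"
      "(real (r n))\<^sup>2 / (?m n + real (r n)) = (real K)\<^sup>2 / (?m n / (?l n)\<^sup>2 + real K / ?l n)"
      by (simp_all add: r_def power_mult_distrib mult.commute)
  qed
  have ev: "\<forall>\<^sub>F n in sequentially. r n < polya_row n"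
  proof -
    have "\<forall>\<^sub>F n in sequentially. ?m n / (?l n)\<^sup>2 - real K / ?l n > 0"
      using order_tendstoD(1)[OF minus, of 0] by simp
    then show ?thesis
    proof eventually_elim
      case (elim n)
      then have "(?m n - real (r n)) / (?l n)\<^sup>2 > 0"
        using l_pos[of n] by (simp add: r_def field_simps power2_eq_square)
      then show ?case
        using l_pos[of n] by (simp add: zero_less_divide_iff)
    qed
  qed
  have "(\<lambda>n. exp (- ((real K)\<^sup>2 / (?m n / (?l n)\<^sup>2 - real K / ?l n)))) \<longlonglongrightarrow> exp (- ((real K)\<^sup>2 / (1 / pi)))"
    by (intro tendsto_intros minus) auto
  then have lower: "(\<lambda>n. exp (- ((real (r n))\<^sup>2 / (?m n - real (r n))))) \<longlonglongrightarrow> exp (- pi * (of_int k)\<^sup>2)"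
    unfolding scale by (simp add: K_def mult.commute)
  have "(\<lambda>n. exp (- ((real K)\<^sup>2 / (?m n / (?l n)\<^sup>2 + real K / ?l n)))) \<longlonglongrightarrow> exp (- ((real K)\<^sup>2 / (1 / pi)))"
    by (intro tendsto_intros plus) auto
  then have upper: "(\<lambda>n. exp (- ((real (r n))\<^sup>2 / (?m n + real (r n))))) \<longlonglongrightarrow> exp (- pi * (of_int k)\<^sup>2)"
    unfolding scale by (simp add: K_def mult.commute)
  show ?thesis
    unfolding cb
  proof (rule tendsto_sandwich[OF _ _ lower upper])
    show "\<forall>\<^sub>F n in sequentially. exp (- ((real (r n))\<^sup>2 / (?m n - real (r n))))
        \<le> central_binom (polya_row n) (int (r n)) / central_binom (polya_row n) 0"
      using ev
    proof eventually_elim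
      case (elim n)
      then show ?case
        using central_binom_ratio_ge[OF elim] by (simp add: of_nat_diff)
    qed
    show "\<forall>\<^sub>F n in sequentially. central_binom (polya_row n) (int (r n)) / central_binom (polya_row n) 0
        \<le> exp (- ((real (r n))\<^sup>2 / (?m n + real (r n))))"
      using ev
    proof eventually_elim
      case (elim n)
      then show ?case
        using central_binom_ratio_le[of "r n" "polya_row n"] by simp
    qed
  qed
qed

lemma polya_binomial_limit:
  "(\<lambda>n. (\<Sum>\<^sub>\<infinity>k::int. cos (2 * pi * \<sigma> * of_int k) * central_binom (polya_row n) (int (polya_modulus n) * k))
      / central_binom (polya_row n) 0)
    \<longlonglongrightarrow> (\<Sum>\<^sub>\<infinity>k::int. cos (2 * pi * \<sigma> * of_int k) * exp (- pi * (of_int k)\<^sup>2))"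
proof -
  have "(\<lambda>n. \<Sum>\<^sub>\<infinity>k::int. cos (2 * pi * \<sigma> * of_int k) *
        (central_binom (polya_row n) (int (polya_modulus n) * k) / central_binom (polya_row n) 0))
    \<longlonglongrightarrow> (\<Sum>\<^sub>\<infinity>k::int. cos (2 * pi * \<sigma> * of_int k) * exp (- pi * (of_int k)\<^sup>2))"
  proof (rule tendsto_infsum_int_dominated)
    show "(\<lambda>n. cos (2 * pi * \<sigma> * of_int k) *
        (central_binom (polya_row n) (int (polya_modulus n) * k) / central_binom (polya_row n) 0))
      \<longlonglongrightarrow> cos (2 * pi * \<sigma> * of_int k) * exp (- pi * (of_int k)\<^sup>2)" for k
      by (intro tendsto_mult tendsto_const central_binom_gaussian_limit)
    show "\<forall>\<^sub>F n in sequentially. \<forall>k. \<bar>cos (2 * pi * \<sigma> * of_int k) *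
        (central_binom (polya_row n) (int (polya_modulus n) * k) / central_binom (polya_row n) 0)\<bar>
        \<le> exp (- (pi / 2) * (of_int k)\<^sup>2)"
    proof (intro always_eventually allI)
      fix n k
      show "\<bar>cos (2 * pi * \<sigma> * of_int k) *
        (central_binom (polya_row n) (int (polya_modulus n) * k) / central_binom (polya_row n) 0)\<bar>
        \<le> exp (- (pi / 2) * (of_int k)\<^sup>2)"
        unfolding abs_mult[of "cos _"]
        using mult_mono[OF abs_cos_le_one[of "2 * pi * \<sigma> * of_int k"] central_binom_gaussian_bound[of n k]]
        by simp
    qed
    show "(\<lambda>k::int. exp (- (pi / 2) * (of_int k)\<^sup>2)) summable_on UNIV"
      using summable_on_gaussian[of "pi / 2" 0] by simp
  qed
  then show ?thesis
    by (simp add: divide_inverse infsum_cmult_left' mult.assoc[symmetric])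
qed

text \<open>On the logarithmic scale, \<open>l^2 * ln (cos (x / l))\<close> tends to
  \<open>- x^2 / 2\<close> while \<open>2 m / l^2\<close> tends to \<open>2 / pi\<close>; the cosine
  is eventually positive.\<close>

lemma power_cos_gaussian_limit:
  "(\<lambda>n. cos (x / real (polya_modulus n)) ^ (2 * polya_row n)) \<longlonglongrightarrow> exp (- (x\<^sup>2 / pi))"
proof -
  let ?l = "\<lambda>n. real (polya_modulus n)" and ?m = "\<lambda>n. real (polya_row n)"
  have "(\<lambda>n. (?l n)\<^sup>2 * ln (cos (x / ?l n))) \<longlonglongrightarrow> - (x * x / 2)"
    unfolding polya_modulus_def by real_asymp
  from tendsto_mult[OF polya_row_limit this]
  have "(\<lambda>n. 2 * (?m n / (?l n)\<^sup>2 * ((?l n)\<^sup>2 * ln (cos (x / ?l n))))) \<longlonglongrightarrow> 2 * (1 / pi * - (x * x / 2))"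
    by (rule tendsto_mult_left)
  then have "(\<lambda>n. exp (2 * (?m n / (?l n)\<^sup>2 * ((?l n)\<^sup>2 * ln (cos (x / ?l n)))))) \<longlonglongrightarrow> exp (- (x\<^sup>2 / pi))"
    by (intro tendsto_exp) (simp add: power2_eq_square)
  moreover have "\<forall>\<^sub>F n in sequentially. exp (2 * (?m n / (?l n)\<^sup>2 * ((?l n)\<^sup>2 * ln (cos (x / ?l n)))))
      = cos (x / ?l n) ^ (2 * polya_row n)"
  proof -
    have "(\<lambda>n. cos (x / ?l n)) \<longlonglongrightarrow> cos 0"
      by (intro tendsto_cos real_tendsto_divide_at_top[OF tendsto_const polya_modulus_at_top])
    then have "\<forall>\<^sub>F n in sequentially. cos (x / ?l n) > 0"
      by (rule order_tendstoD(1)) simp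
    then show ?thesis
    proof eventually_elim
      case (elim n)
      have "2 * (?m n / (?l n)\<^sup>2 * ((?l n)\<^sup>2 * ln (cos (x / ?l n)))) = real (2 * polya_row n) * ln (cos (x / ?l n))"
        by (simp add: polya_modulus_def)
      then show ?case
        using elim by (simp only: exp_of_nat_mult exp_ln)
    qed
  qed
  ultimately show ?thesis
    by (rule Lim_transform_eventually)
qed

text \<open>The residue class identity turns the expression into a finite sum of cosine powers. With
  centred residues all angles lie within \<open>pi / 2\<close> of zero, where the Gaussian bound for
  the cosine supplies the majorant.\<close>

lemma polya_cosine_limit:
  assumes \<sigma>: "0 \<le> \<sigma>" "\<sigma> \<le> 1 / 2"
  shows "(\<lambda>n. real (polya_modulus n) *
      (\<Sum>\<^sub>\<infinity>k::int. cos (2 * pi * \<sigma> * of_int k) * central_binom (polya_row n) (int (polya_modulus n) * k))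
      / 4 ^ polya_row n)
    \<longlonglongrightarrow> (\<Sum>\<^sub>\<infinity>j::int. exp (- pi * (of_int j + \<sigma>)\<^sup>2))"
proof -
  define a where "a = (\<lambda>n j. if j \<in> {- int (Suc n)..<int (Suc n)}
    then cos (pi * (of_int j + \<sigma>) / real (polya_modulus n)) ^ (2 * polya_row n) else 0)"
  have eq: "real (polya_modulus n) *
      (\<Sum>\<^sub>\<infinity>k::int. cos (2 * pi * \<sigma> * of_int k) * central_binom (polya_row n) (int (polya_modulus n) * k))
      / 4 ^ polya_row n = (\<Sum>\<^sub>\<infinity>j. a n j)" for n
  proof -
    let ?l = "polya_modulus n" and ?m = "polya_row n"
    \<comment> \<open>Subtracting the integer \<open>Suc n\<close> from \<open>\<sigma>\<close>
      leaves these cosines unchanged but moves the residues to the symmetric range.\<close>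
    have "cos (2 * pi * \<sigma> * of_int k) = cos (2 * pi * (\<sigma> - real (Suc n)) * of_int k)" for k :: int
    proof -
      have "2 * pi * \<sigma> * of_int k = 2 * pi * (\<sigma> - real (Suc n)) * of_int k + 2 * pi * of_int (int (Suc n) * k)"
        by (simp add: algebra_simps)
      then show ?thesis
        using sin_int_2pin[of "int (Suc n) * k"] cos_int_2pin[of "int (Suc n) * k"]
        by (simp add: cos_add)
    qed
    then have "real ?l * (\<Sum>\<^sub>\<infinity>k::int. cos (2 * pi * \<sigma> * of_int k) * central_binom ?m (int ?l * k)) =
        (\<Sum>j<?l. (2 * cos (pi * (of_nat j + (\<sigma> - real (Suc n))) / of_nat ?l)) ^ (2 * ?m))"
      using binomial_sum_residue_class[of ?l "\<sigma> - real (Suc n)" ?m] by (simp add: polya_modulus_def)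
    also have "\<dots> / 4 ^ ?m = (\<Sum>j<?l. cos (pi * (of_nat j + (\<sigma> - real (Suc n))) / of_nat ?l) ^ (2 * ?m))"
      unfolding sum_divide_distrib by (intro sum.cong) (auto simp: power_mult_distrib power_mult)
    also have "\<dots> = (\<Sum>j\<in>{- int (Suc n)..<int (Suc n)}. a n j)"
      by (rule sum.reindex_bij_witness[of _ "\<lambda>j. nat (j + int (Suc n))" "\<lambda>j. int j - int (Suc n)"])
        (auto simp: a_def polya_modulus_def algebra_simps)
    also have "\<dots> = (\<Sum>\<^sub>\<infinity>j\<in>{- int (Suc n)..<int (Suc n)}. a n j)"
      by simp
    also have "\<dots> = (\<Sum>\<^sub>\<infinity>j. a n j)"
      by (rule infsum_cong_neutral) (auto simp: a_def)
    finally show ?thesis .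
  qed
  have "(\<lambda>n. \<Sum>\<^sub>\<infinity>j. a n j) \<longlonglongrightarrow> (\<Sum>\<^sub>\<infinity>j::int. exp (- pi * (of_int j + \<sigma>)\<^sup>2))"
  proof (rule tendsto_infsum_int_dominated)
    fix j :: int
    have "(\<lambda>n. cos (pi * (of_int j + \<sigma>) / real (polya_modulus n)) ^ (2 * polya_row n)) \<longlonglongrightarrow>
        exp (- pi * (of_int j + \<sigma>)\<^sup>2)"
      using power_cos_gaussian_limit[of "pi * (of_int j + \<sigma>)"]
      by (simp add: power_mult_distrib power2_eq_square[of pi])
    moreover have "\<forall>\<^sub>F n in sequentially.
        cos (pi * (of_int j + \<sigma>) / real (polya_modulus n)) ^ (2 * polya_row n) = a n j"
      using eventually_ge_at_top[of "nat \<bar>j\<bar>"] by eventually_elim (auto simp: a_def)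
    ultimately show "(\<lambda>n. a n j) \<longlonglongrightarrow> exp (- pi * (of_int j + \<sigma>)\<^sup>2)"
      by (rule Lim_transform_eventually)
  next
    show "\<forall>\<^sub>F n in sequentially. \<forall>j. \<bar>a n j\<bar> \<le> exp (- (pi / 4) * (of_int j + \<sigma>)\<^sup>2)"
    proof (intro always_eventually allI)
      fix n j
      show "\<bar>a n j\<bar> \<le> exp (- (pi / 4) * (of_int j + \<sigma>)\<^sup>2)"
      proof (cases "j \<in> {- int (Suc n)..<int (Suc n)}")
        case True
        define l where "l = real (polya_modulus n)"
        define x where "x = pi * (of_int j + \<sigma>) / l"
        have l: "l = 2 * real (Suc n)" "l > 0"
          by (auto simp: polya_modulus_def l_def)
        have "- int (Suc n) \<le> j" "j + 1 \<le> int (Suc n)"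
          using True by auto
        then have "- real (Suc n) \<le> of_int j" "of_int j + 1 \<le> real (Suc n)"
          by linarith+
        then have "\<bar>of_int j + \<sigma>\<bar> \<le> l / 2"
          using \<sigma> unfolding l(1) abs_le_iff by auto
        then have "pi * \<bar>of_int j + \<sigma>\<bar> / l \<le> pi * (l / 2) / l"
          using l by (intro divide_right_mono mult_left_mono) auto
        then have x: "\<bar>x\<bar> \<le> pi / 2"
          using l(2) by (simp add: x_def abs_mult)
        then have "0 \<le> cos x" "cos x \<le> exp (- (x\<^sup>2 / 4))"
          by (auto intro!: cos_ge_zero cos_le_gaussian)
        then have "cos x ^ (2 * polya_row n) \<le> exp (- (x\<^sup>2 / 4)) ^ (2 * polya_row n)"
          by (intro power_mono)
        also have "\<dots> = exp (- (real (polya_row n) * x\<^sup>2 / 2))"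
          unfolding exp_of_nat_mult[symmetric] by simp
        also have "\<dots> \<le> exp (- (pi / 4) * (of_int j + \<sigma>)\<^sup>2)"
        proof -
          have "pi / 4 * (of_int j + \<sigma>)\<^sup>2 = l\<^sup>2 / (2 * pi) * x\<^sup>2 / 2"
            using l(2) by (simp add: x_def power2_eq_square field_simps)
          also have "\<dots> \<le> real (polya_row n) * x\<^sup>2 / 2"
            using polya_row_bounds(3)[of n]
            by (intro divide_right_mono mult_right_mono) (auto simp: l_def field_simps)
          finally show ?thesis by simp
        qed
        finally show ?thesis
          using True \<open>0 \<le> cos x\<close> by (simp add: a_def x_def l_def)
      qed (auto simp: a_def)
    qed
    show "(\<lambda>j::int. exp (- (pi / 4) * (of_int j + \<sigma>)\<^sup>2)) summable_on UNIV"
      using \<sigma> by (intro summable_on_gaussian) auto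
  qed
  then show ?thesis
    unfolding eq .
qed

lemma theta3_pos:
  assumes "s > 0"
  shows "theta3 s > 0"
  unfolding theta_products(1)[OF assms]
  using assms less_trans[OF _ exp_gt_zero, of "- 1" "- s"]
  by (intro mult_pos_pos zero_less_power qpoch_inf_pos) (auto simp: abs_square_less_1)

text \<open>Poisson summation for the self-dual Gaussian. No Stirling formula is needed: at
  \<open>\<sigma> = 0\<close> both limits are \<open>theta3 pi\<close>, which forces the normalising
  factor \<open>c n * b n\<close> to tend to 1, and this factor does not depend on
  \<open>\<sigma>\<close>.\<close>

lemma theta_poisson_at_pi:
  assumes \<sigma>: "0 \<le> \<sigma>" "\<sigma> \<le> 1 / 2"
  shows "(\<Sum>\<^sub>\<infinity>k::int. cos (2 * pi * \<sigma> * of_int k) * exp (- pi * (of_int k)\<^sup>2)) =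
    (\<Sum>\<^sub>\<infinity>j::int. exp (- pi * (of_int j + \<sigma>)\<^sup>2))"
proof -
  define S where "S = (\<lambda>\<sigma> n. \<Sum>\<^sub>\<infinity>k::int. cos (2 * pi * \<sigma> * of_int k) *
    central_binom (polya_row n) (int (polya_modulus n) * k))"
  define b where "b = (\<lambda>n. central_binom (polya_row n) 0)"
  define c where "c = (\<lambda>n. real (polya_modulus n) / 4 ^ polya_row n)"
  have b: "b n \<noteq> 0" for n
    by (simp add: b_def central_binom_def)
  have T: "theta3 pi \<noteq> 0"
    using theta3_pos[of pi] by simp
  have 1: "(\<lambda>n. S 0 n / b n) \<longlonglongrightarrow> theta3 pi"
    using polya_binomial_limit[of 0] by (simp add: S_def b_def theta3_def)
  have 2: "(\<lambda>n. c n * S 0 n) \<longlonglongrightarrow> theta3 pi"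
    using polya_cosine_limit[of 0] by (simp add: S_def c_def theta3_def)
  have "(\<lambda>n. (c n * S 0 n) / (S 0 n / b n)) \<longlonglongrightarrow> theta3 pi / theta3 pi"
    by (intro tendsto_divide 1 2 T)
  then have "(\<lambda>n. (c n * S 0 n) / (S 0 n / b n)) \<longlonglongrightarrow> 1"
    using T by simp
  moreover have "\<forall>\<^sub>F n in sequentially. (c n * S 0 n) / (S 0 n / b n) = c n * b n"
    using tendsto_imp_eventually_ne[OF 1 T] by eventually_elim auto
  ultimately have "(\<lambda>n. c n * b n) \<longlonglongrightarrow> 1"
    by (rule Lim_transform_eventually)
  from tendsto_mult[OF this polya_binomial_limit[of \<sigma>]]
  have "(\<lambda>n. c n * S \<sigma> n) \<longlonglongrightarrow> (\<Sum>\<^sub>\<infinity>k::int. cos (2 * pi * \<sigma> * of_int k) * exp (- pi * (of_int k)\<^sup>2))"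
    using b by (simp add: S_def b_def)
  moreover have "(\<lambda>n. c n * S \<sigma> n) \<longlonglongrightarrow> (\<Sum>\<^sub>\<infinity>j::int. exp (- pi * (of_int j + \<sigma>)\<^sup>2))"
    using polya_cosine_limit[OF \<sigma>] by (simp add: S_def c_def)
  ultimately show ?thesis
    by (rule LIMSEQ_unique)
qed

lemma theta4_eq_theta2_at_pi: "theta4 pi = theta2 pi"
proof -
  have "cos (2 * pi * (1 / 2) * of_int k) = (if even k then 1 else - 1)" for k :: int
    by (simp add: cos_npi_int)
  then show ?thesis
    using theta_poisson_at_pi[of "1 / 2"] by (simp add: theta4_def theta2_def)
qed

section \<open>The modular equation of degree three\<close>

context
  fixes s q :: real
  assumes s: "s > 0"
  defines "q \<equiv> exp (- s)"
begin

lemma nome_bounds: "0 < q" "q < 1" "0 < q\<^sup>2" "q\<^sup>2 < 1" "- 1 < q"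
  using s less_trans[OF _ exp_gt_zero, of "- 1" "- s"] by (auto simp: q_def abs_square_less_1)

lemma nome_qpoch_pos: "qpoch_inf (- q) (q\<^sup>2) > 0" "qpoch_inf q (q\<^sup>2) > 0"
  "qpoch_inf (- (q\<^sup>2)) (q\<^sup>2) > 0" "qpoch_inf (q\<^sup>2) (q\<^sup>2) > 0"
  using nome_bounds by (intro qpoch_inf_pos; linarith)+

lemma theta2_pos: "theta2 s > 0" and theta4_pos: "theta4 s > 0"
  using nome_qpoch_pos unfolding theta_products(2,3)[OF s, folded q_def] by auto

text \<open>Euler's theorem on odd and distinct parts, in base \<open>q^2\<close>. The first two
  factors combine by difference of squares; splitting \<open>qpoch_inf (q^2) (q^2)\<close> by parity
  then allows cancellation of \<open>?E\<close>.\<close>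

lemma qpoch_inf_euler:
  "qpoch_inf (- q) (q\<^sup>2) * qpoch_inf q (q\<^sup>2) * qpoch_inf (- (q\<^sup>2)) (q\<^sup>2) = 1"
proof -
  let ?E = "qpoch_inf ((q\<^sup>2)\<^sup>2) ((q\<^sup>2)\<^sup>2)"
  have q4: "(q\<^sup>2)\<^sup>2 < 1" "0 \<le> (q\<^sup>2)\<^sup>2"
    unfolding abs_square_less_1 using nome_bounds by auto
  then have E: "?E > 0"
    by (intro qpoch_inf_pos) auto
  have 1: "qpoch_inf (- q) (q\<^sup>2) * qpoch_inf q (q\<^sup>2) = qpoch_inf (q\<^sup>2) ((q\<^sup>2)\<^sup>2)"
    using qpoch_inf_plus_minus[of "q\<^sup>2" q] nome_bounds by (simp add: mult.commute)
  have 2: "qpoch_inf (q\<^sup>2) (q\<^sup>2) * qpoch_inf (- (q\<^sup>2)) (q\<^sup>2) = ?E"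
    using nome_bounds by (intro qpoch_inf_plus_minus) auto
  have "qpoch_inf (q\<^sup>2) (q\<^sup>2) = qpoch_inf (q\<^sup>2) ((q\<^sup>2)\<^sup>2) * qpoch_inf (q\<^sup>2 * q\<^sup>2) ((q\<^sup>2)\<^sup>2)"
    using nome_bounds by (intro qpoch_inf_even_odd) auto
  then have "qpoch_inf (q\<^sup>2) (q\<^sup>2) = qpoch_inf (q\<^sup>2) ((q\<^sup>2)\<^sup>2) * ?E"
    by (simp flip: power2_eq_square)
  with 2 have "(qpoch_inf (q\<^sup>2) ((q\<^sup>2)\<^sup>2) * qpoch_inf (- (q\<^sup>2)) (q\<^sup>2)) * ?E = 1 * ?E"
    by (simp add: mult_ac)
  then have "qpoch_inf (q\<^sup>2) ((q\<^sup>2)\<^sup>2) * qpoch_inf (- (q\<^sup>2)) (q\<^sup>2) = 1"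
    by (subst (asm) mult_right_cancel) (use E in auto)
  then show ?thesis
    unfolding 1 .
qed

lemma root_exp: "n > 0 \<Longrightarrow> root n q = exp (- s / real n)"
  by (rule real_root_pos_unique) (auto simp: q_def simp flip: exp_of_nat_mult)

lemma S2_power2: "(S2 q)\<^sup>2 = theta2 s / (2 * theta4 s)"
proof -
  have "(root 8 q)\<^sup>2 = exp (- s / 4)"
    by (simp add: root_exp flip: exp_of_nat_mult)
  then show ?thesis
    unfolding S2_def theta_products(2,3)[OF s, folded q_def]
    using nome_qpoch_pos by (simp add: power_mult_distrib power_divide)
qed

lemma S2_pos: "S2 q > 0"
  unfolding S2_def using nome_qpoch_pos nome_bounds by simp

lemma S2_eq_sqrt: "S2 q = sqrt (theta2 s / theta4 s / 2)"
  using real_sqrt_unique[OF S2_power2] S2_pos by (simp add: mult.commute)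

text \<open>Splitting the product in base \<open>- q\<close> by parity isolates the factor that
  cancels the denominator.\<close>

lemma class_invariant_product:
  assumes "s = pi * sqrt n"
  shows "class_invariant_G n = qpoch_inf (- q) (q\<^sup>2) / (root 4 2 * root 24 q)"
proof -
  have q: "exp (- (pi * sqrt n)) = q"
    by (simp add: q_def assms)
  have "qpoch_inf (- q) (- q) = qpoch_inf (- q) ((- q)\<^sup>2) * qpoch_inf (- q * - q) ((- q)\<^sup>2)"
    using nome_bounds by (intro qpoch_inf_even_odd) auto
  then have "qpoch_inf (- q) (- q) = qpoch_inf (- q) (q\<^sup>2) * qpoch_inf (q\<^sup>2) (q\<^sup>2)"
    by (simp add: power2_eq_square)
  then show ?thesis
    unfolding class_invariant_G_def q Let_def ramanujan_f_def
    using nome_qpoch_pos by simp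
qed

lemma class_invariant_pos:
  assumes "s = pi * sqrt n"
  shows "class_invariant_G n > 0"
  unfolding class_invariant_product[OF assms] using nome_qpoch_pos nome_bounds by simp

text \<open>Jacobi's quartic identity gives \<open>x^4 + 1 = (A / B)^8\<close>, and the products
  give \<open>x^2 = 4 e (C / B)^4\<close>. In the quotient everything but
  \<open>A^12 / (4 e)\<close> collects into \<open>A * B * C\<close>, which is 1 by Euler.\<close>

lemma class_invariant_theta:
  assumes "s = pi * sqrt n"
  shows "2 * class_invariant_G n ^ 12 = (theta2 s / theta4 s)\<^sup>2 + 1 / (theta2 s / theta4 s)\<^sup>2"
proof -
  define A B C e where "A = qpoch_inf (- q) (q\<^sup>2)" and "B = qpoch_inf q (q\<^sup>2)"
    and "C = qpoch_inf (- (q\<^sup>2)) (q\<^sup>2)" and "e = exp (- s / 2)"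
  have pos: "A > 0" "B > 0" "C > 0" "e > 0"
    using nome_qpoch_pos by (auto simp: A_def B_def C_def e_def)
  have euler: "A * B * C = 1"
    using qpoch_inf_euler by (simp add: A_def B_def C_def)
  have root_2: "root 4 2 ^ 4 = (2 :: real)"
    by simp
  have "root 4 2 ^ 12 = ((root 4 2 ^ 4) ^ 3 :: real)"
    unfolding power_mult[symmetric] by simp
  then have "root 4 2 ^ 12 = (8 :: real)"
    unfolding root_2 by simp
  moreover have "root 24 q ^ 12 = e"
    by (simp add: root_exp e_def flip: exp_of_nat_mult)
  ultimately have G: "class_invariant_G n ^ 12 = A ^ 12 / (8 * e)"
    unfolding class_invariant_product[OF assms] A_def by (simp add: power_divide power_mult_distrib)
  define x where "x = theta2 s / theta4 s"
  have "exp (- s / 4) ^ 2 = e"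
    by (simp add: e_def flip: exp_of_nat_mult)
  moreover have "x = 2 * exp (- s / 4) * C\<^sup>2 / B\<^sup>2"
    using nome_qpoch_pos unfolding x_def theta_products(2,3)[OF s, folded q_def] B_def C_def by simp
  ultimately have x2: "x\<^sup>2 = 4 * e * C ^ 4 / B ^ 4"
    by (simp add: power_divide power_mult_distrib flip: power_mult)
  have "theta3 s / theta4 s = A\<^sup>2 / B\<^sup>2"
    using nome_qpoch_pos unfolding theta_products(1,2)[OF s, folded q_def] A_def B_def by simp
  then have "(theta3 s / theta4 s) ^ 4 = A ^ 8 / B ^ 8"
    by (simp add: power_divide flip: power_mult)
  moreover have "(theta3 s / theta4 s) ^ 4 = x ^ 4 + 1"
    using jacobi_quartic[OF s] theta4_pos by (simp add: x_def power_divide field_simps)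
  ultimately have x4: "x ^ 4 + 1 = A ^ 8 / B ^ 8" by simp
  have "x > 0"
    using theta2_pos theta4_pos by (simp add: x_def)
  then have "x\<^sup>2 + 1 / x\<^sup>2 = (x ^ 4 + 1) / x\<^sup>2"
    by (simp add: field_simps power2_eq_square power4_eq_xxxx)
  also have "\<dots> = (A ^ 8 / B ^ 8) / (4 * e * C ^ 4 / B ^ 4)"
    unfolding x4 unfolding x2 ..
  also have "\<dots> = A ^ 12 / (4 * e * (A * B * C) ^ 4)"
    using pos by (simp add: power_mult_distrib field_simps flip: power_add)
  finally show ?thesis
    unfolding G x_def[symmetric] euler by simp
qed

text \<open>The cubic identity divided by its \<open>theta4\<close> term, raised to the fourth
  power; the quartic identity then eliminates \<open>theta3\<close>.\<close>

lemma modular_equation_degree_3: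
  "(1 + theta2 s / theta4 s * (theta2 (3 * s) / theta4 (3 * s))) ^ 4 =
    (1 + (theta2 s / theta4 s) ^ 4) * (1 + (theta2 (3 * s) / theta4 (3 * s)) ^ 4)"
  if "theta4 (3 * s) > 0"
proof -
  have quartic: "1 + (theta2 t / theta4 t) ^ 4 = (theta3 t / theta4 t) ^ 4" if "t > 0" "theta4 t > 0" for t
    using jacobi_quartic[OF that(1)] that by (simp add: power_divide field_simps)
  have "1 + theta2 s / theta4 s * (theta2 (3 * s) / theta4 (3 * s)) =
      theta3 s / theta4 s * (theta3 (3 * s) / theta4 (3 * s))"
    using theta_cubic[OF s] theta4_pos that by (simp add: field_simps)
  then show ?thesis
    using quartic[OF s theta4_pos] quartic[of "3 * s"] s that
    by (simp add: power_mult_distrib power_divide)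
qed

end

text \<open>As the nome grows, the numerator product does not decrease and the denominator does not
  increase; the eighth root supplies strictness.\<close>

lemma S2_strict_antimono:
  assumes "0 < s" "s < t"
  shows "S2 (exp (- t)) < S2 (exp (- s))"
proof -
  define q r where "q = exp (- s)" and "r = exp (- t)"
  have t: "0 < t" using assms by simp
  note q = nome_bounds[OF assms(1), folded q_def] nome_qpoch_pos[OF assms(1), folded q_def]
  note r = nome_bounds[OF t, folded r_def] nome_qpoch_pos[OF t, folded r_def]
  have rq: "r < q" using assms by (simp add: q_def r_def)
  have pw: "r ^ k \<le> q ^ k" for k
    using rq r by (intro power_mono) auto
  have "qpoch_inf (- (r\<^sup>2)) (r\<^sup>2) \<le> qpoch_inf (- (q\<^sup>2)) (q\<^sup>2)"
  proof (rule qpoch_inf_antimono)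
    show "- (q\<^sup>2) * (q\<^sup>2) ^ k \<le> - (r\<^sup>2) * (r\<^sup>2) ^ k" for k
      using pw[of "2 + 2 * k"] unfolding power_add power_mult by simp
  qed (use q r in linarith)+
  moreover have "qpoch_inf q (q\<^sup>2) \<le> qpoch_inf r (r\<^sup>2)"
  proof (rule qpoch_inf_antimono)
    show "r * (r\<^sup>2) ^ k \<le> q * (q\<^sup>2) ^ k" for k
      using pw[of "1 + 2 * k"] by (simp add: power_add power_mult)
  qed (use q r in auto)
  ultimately have "qpoch_inf (- (r\<^sup>2)) (r\<^sup>2) / qpoch_inf r (r\<^sup>2) \<le> qpoch_inf (- (q\<^sup>2)) (q\<^sup>2) / qpoch_inf q (q\<^sup>2)"
    using q r by (intro frac_le) auto
  moreover have "root 8 r < root 8 q"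
    using rq by simp
  ultimately have "root 8 r * (qpoch_inf (- (r\<^sup>2)) (r\<^sup>2) / qpoch_inf r (r\<^sup>2)) <
      root 8 q * (qpoch_inf (- (q\<^sup>2)) (q\<^sup>2) / qpoch_inf q (q\<^sup>2))"
    using q r by (intro mult_less_le_imp_less) auto
  then show ?thesis
    by (simp add: S2_def q_def r_def)
qed

lemma theta_quotient_strict_antimono:
  assumes "0 < s" "s < t"
  shows "theta2 t / theta4 t < theta2 s / theta4 s"
proof -
  have "(S2 (exp (- t)))\<^sup>2 < (S2 (exp (- s)))\<^sup>2"
    using S2_strict_antimono[OF assms] S2_pos[of t] assms by (intro power_strict_mono) auto
  then show ?thesis
    using S2_power2[of s] S2_power2[of t] assms by simp
qed

lemma theta_quotient_le_1:
  assumes "s \<ge> pi"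
  shows "theta2 s / theta4 s \<le> 1"
proof -
  have "theta2 pi / theta4 pi = 1"
    using theta4_eq_theta2_at_pi theta4_pos[of pi] by simp
  then show ?thesis
    using theta_quotient_strict_antimono[of pi s] assms by (cases "s = pi") auto
qed

text \<open>For \<open>t = y / x\<close> the degree three equation becomes
  \<open>t\<^sup>4 - 4 x\<^sup>2 t\<^sup>3 - 6 t\<^sup>2 - 4 t / x\<^sup>2 + 1 = 0\<close>. Over the field generated by \<open>h\<close> and \<open>R\<close> below
  this splits into two quadratics, of which one has no positive root.\<close>

lemma modular_equation_degree_3_solution:
  fixes x y g h R :: real
  defines "\<tau> \<equiv> y / x * (g + h)"
  assumes x: "0 < x" "x \<le> 1" and y: "0 < y"
    and eq: "(1 + x * y) ^ 4 = (1 + x ^ 4) * (1 + y ^ 4)"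
    and g: "0 < g" "2 * g ^ 3 = x\<^sup>2 + 1 / x\<^sup>2"
    and h: "h\<^sup>2 = g\<^sup>2 - 1" "0 \<le> h" and R: "R\<^sup>2 = g ^ 4 + g\<^sup>2 + 1" "0 \<le> R"
  shows "\<tau>\<^sup>2 - 2 * (g\<^sup>2 + R) * \<tau> + 1 = 0" and "x\<^sup>2 = g ^ 3 - h * R"
proof -
  define X where "X = x\<^sup>2"
  have X: "0 < X" "X \<le> 1" using x by (auto simp: X_def power_le_one)
  have gX: "2 * g ^ 3 = X + 1 / X" using g by (simp add: X_def)
  \<comment> \<open>This is \<open>(g^2 - 1) * (g^4 + g^2 + 1) = g^6 - 1\<close>.\<close>
  have "(h * R)\<^sup>2 = (g ^ 3)\<^sup>2 - 1"
    unfolding power_mult_distrib h R by (simp add: algebra_simps eval_nat_numeral)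
  also have "\<dots> = ((1 / X - X) / 2)\<^sup>2"
  proof -
    have g3: "g ^ 3 = (1 / X + X) / 2" using gX by simp
    have "((1 / X + X) / 2)\<^sup>2 - ((1 / X - X) / 2)\<^sup>2 = X * (1 / X)"
      by (simp add: power2_eq_square algebra_simps add_divide_distrib diff_divide_distrib)
    then show ?thesis unfolding g3 using X by simp
  qed
  finally have square: "(h * R)\<^sup>2 = ((1 / X - X) / 2)\<^sup>2" .
  \<comment> \<open>Here \<open>x \<le> 1\<close> selects the sign of the square root, and with it
    which of \<open>X\<close> and \<open>1 / X\<close> is \<open>g^3 - h * R\<close>.\<close>
  have "1 \<le> 1 / X"
    using X by simp
  then have "X \<le> 1 / X"
    by (rule order_trans[OF X(2)])
  then have "0 \<le> (1 / X - X) / 2"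
    by simp
  then have "h * R = (1 / X - X) / 2"
    using power2_eq_imp_eq[OF square] h R by simp
  with gX have X_eq: "X = g ^ 3 - h * R" and invX: "1 / X = g ^ 3 + h * R"
    by (simp_all add: field_simps)
  show "x\<^sup>2 = g ^ 3 - h * R" using X_eq by (simp add: X_def)
  define t where "t = y / x"
  have t: "t > 0" "y = x * t" using x y by (auto simp: t_def)
  have "(1 + X * t) ^ 4 = (1 + X\<^sup>2) * (1 + X\<^sup>2 * t ^ 4)"
    using eq unfolding t(2) X_def by (simp add: power_mult_distrib algebra_simps flip: power_mult power_add)
      (simp add: power2_eq_square mult_ac)
  then have "X\<^sup>2 * (t ^ 4 - 4 * X * t ^ 3 - 6 * t\<^sup>2 - 4 * (1 / X) * t + 1) = 0"
    using X by (simp add: field_simps eval_nat_numeral)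
  then have quartic: "t ^ 4 - 4 * X * t ^ 3 - 6 * t\<^sup>2 - 4 * (1 / X) * t + 1 = 0"
    using X by simp
  have unit: "(g - h) * (g + h) = 1"
    using h by (simp add: algebra_simps power2_eq_square)
  have "(t\<^sup>2 - 2 * (g - h) * (g\<^sup>2 + R) * t + (g - h)\<^sup>2) * (t\<^sup>2 + 2 * (g + h) * (R - g\<^sup>2) * t + (g + h)\<^sup>2) =
      t ^ 4 - 4 * (g ^ 3 - h * R) * t ^ 3 - 6 * t\<^sup>2 - 4 * (g ^ 3 + h * R) * t + 1"
    using unit h(1) R(1) by algebra
  also have "\<dots> = 0"
    using quartic unfolding invX unfolding X_eq .
  finally have factors: "(t\<^sup>2 - 2 * (g - h) * (g\<^sup>2 + R) * t + (g - h)\<^sup>2) *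
      (t\<^sup>2 + 2 * (g + h) * (R - g\<^sup>2) * t + (g + h)\<^sup>2) = 0" .
  \<comment> \<open>\<open>R \<ge> g^2\<close> makes all coefficients of the second factor
    nonnegative, so it has no positive root.\<close>
  have "(g\<^sup>2)\<^sup>2 \<le> R\<^sup>2"
    unfolding R by (simp add: power_mult[symmetric])
  then have "g\<^sup>2 \<le> R"
    using R(2) power2_le_imp_le by blast
  then have "t\<^sup>2 + 2 * (g + h) * (R - g\<^sup>2) * t + (g + h)\<^sup>2 > 0"
    using t g h by (intro add_pos_nonneg) auto
  then have "t\<^sup>2 - 2 * (g - h) * (g\<^sup>2 + R) * t + (g - h)\<^sup>2 = 0"
    using factors by simp
  \<comment> \<open>Rescaling \<open>t\<close> by \<open>g + h\<close>, the inverse of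
    \<open>g - h\<close>, makes the quadratic reciprocal.\<close>
  then have "(g + h)\<^sup>2 * (t\<^sup>2 - 2 * (g - h) * (g\<^sup>2 + R) * t + (g - h)\<^sup>2) = 0"
    by simp
  moreover have "\<tau> = t * (g + h)"
    by (simp add: \<tau>_def t_def)
  ultimately show "\<tau>\<^sup>2 - 2 * (g\<^sup>2 + R) * \<tau> + 1 = 0"
    using unit by algebra
qed

section \<open>Choice of the roots and the closed forms\<close>

lemma quadratic_two_roots:
  fixes a b \<alpha> \<beta> :: real
  assumes "a < b" "\<alpha> \<le> \<beta>" and a: "a\<^sup>2 - (\<alpha> + \<beta>) * a + \<alpha> * \<beta> = 0" and b: "b\<^sup>2 - (\<alpha> + \<beta>) * b + \<alpha> * \<beta> = 0"
  shows "a = \<alpha>" "b = \<beta>"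
proof -
  have "(a - \<alpha>) * (a - \<beta>) = 0" "(b - \<alpha>) * (b - \<beta>) = 0"
    using a b by (simp_all add: power2_eq_square algebra_simps)
  then show "a = \<alpha>" "b = \<beta>"
    using assms(1,2) by auto
qed

theorem theorem4p3:
  fixes n G :: real
  assumes "n \<in> \<rat>" and "n > 0" and "n \<ge> 1"
  defines "G \<equiv> class_invariant_G n"
  shows "S2 (exp (- (3 * pi * sqrt n))) =
      1 / sqrt 2 * root 4 (G ^ 12 - sqrt (G ^ 24 - 1)) * sqrt (G ^ 4 - sqrt (G ^ 8 - 1)) *
      (sqrt ((G ^ 8 + 1 + sqrt (G ^ 16 + G ^ 8 + 1)) / 2)
        - sqrt ((G ^ 8 - 1 + sqrt (G ^ 16 + G ^ 8 + 1)) / 2))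
    \<and> S2 (exp (- (pi * sqrt n / 3))) =
      1 / sqrt 2 * root 4 (G ^ 12 - sqrt (G ^ 24 - 1)) * sqrt (G ^ 4 - sqrt (G ^ 8 - 1)) *
      (sqrt ((G ^ 8 + 1 + sqrt (G ^ 16 + G ^ 8 + 1)) / 2)
        + sqrt ((G ^ 8 - 1 + sqrt (G ^ 16 + G ^ 8 + 1)) / 2))"
proof -
  define s where "s = pi * sqrt n"
  define x y1 y2 where "x = theta2 s / theta4 s"
    and "y1 = theta2 (3 * s) / theta4 (3 * s)" and "y2 = theta2 (s / 3) / theta4 (s / 3)"
  \<comment> \<open>\<open>n \<ge> 1\<close> enters here: it puts \<open>s\<close> at or beyond the
    fixed point \<open>pi\<close>, whence \<open>x \<le> 1\<close>.\<close>
  have s: "s \<ge> pi" "s > 0"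
    using assms(2,3) by (auto simp: s_def)
  have pos: "x > 0" "y1 > 0" "y2 > 0"
    using s theta2_pos theta4_pos by (auto simp: x_def y1_def y2_def)
  have x1: "x \<le> 1"
    unfolding x_def by (rule theta_quotient_le_1[OF s(1)])
  have y12: "y1 < y2"
    unfolding y1_def y2_def using s by (intro theta_quotient_strict_antimono) auto
  have eq1: "(1 + x * y1) ^ 4 = (1 + x ^ 4) * (1 + y1 ^ 4)"
    unfolding x_def y1_def using s by (intro modular_equation_degree_3 theta4_pos) auto
  \<comment> \<open>The modular equation is symmetric in its two quotients; at \<open>s / 3\<close>
    the value at the tripled argument is \<open>x\<close>.\<close>
  have eq2: "(1 + x * y2) ^ 4 = (1 + x ^ 4) * (1 + y2 ^ 4)"
    using modular_equation_degree_3[of "s / 3"] s theta4_pos[OF s(2)]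
    by (simp add: x_def y2_def mult.commute)
  define g h R where "g = G ^ 4" and "h = sqrt (g\<^sup>2 - 1)" and "R = sqrt (g ^ 4 + g\<^sup>2 + 1)"
  have "G > 0"
    unfolding G_def using s s_def by (rule_tac class_invariant_pos[of s]) auto
  then have g0: "g > 0" by (simp add: g_def)
  have g3: "2 * g ^ 3 = x\<^sup>2 + 1 / x\<^sup>2"
    using class_invariant_theta[OF s(2) s_def] by (simp add: g_def x_def G_def flip: power_mult)
  \<comment> \<open>This yields \<open>x^2 + 1 / x^2 \<ge> 2\<close>, so \<open>g \<ge> 1\<close>
    and the radicand of \<open>h\<close> is nonnegative.\<close>
  have "0 \<le> (x - 1 / x)\<^sup>2" by simp
  then have "1 \<le> g ^ 3"
    using g3 pos by (simp add: power2_diff power_divide)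
  then have g1: "g \<ge> 1"
    using g0 power_less_one_iff[of g 3] by (auto simp: not_less[symmetric])
  then have "g\<^sup>2 \<ge> 1" by simp
  then have h: "h\<^sup>2 = g\<^sup>2 - 1" "h \<ge> 0" by (auto simp: h_def)
  have R: "R\<^sup>2 = g ^ 4 + g\<^sup>2 + 1" "R \<ge> 0" by (auto simp: R_def)
  define P M where "P = (g\<^sup>2 + 1 + R) / 2" and "M = (g\<^sup>2 - 1 + R) / 2"
  have PM: "0 \<le> M" "M \<le> P" "P + M = g\<^sup>2 + R" "P - M = 1"
    using \<open>g\<^sup>2 \<ge> 1\<close> R by (auto simp: P_def M_def field_simps)
  \<comment> \<open>The roots of the quadratic written as squares: \<open>P - M = 1\<close> gives
    product 1, and \<open>2 * (P + M)\<close> is the required sum.\<close>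
  define \<alpha> \<beta> where "\<alpha> = (sqrt P - sqrt M)\<^sup>2" and "\<beta> = (sqrt P + sqrt M)\<^sup>2"
  have "\<alpha> \<le> \<beta>"
    unfolding \<alpha>_def \<beta>_def using PM by (intro power_mono) auto
  have sum: "\<alpha> + \<beta> = 2 * (g\<^sup>2 + R)"
    using PM by (simp add: \<alpha>_def \<beta>_def power2_diff power2_sum)
  have "\<alpha> * \<beta> = ((sqrt P)\<^sup>2 - (sqrt M)\<^sup>2)\<^sup>2"
    unfolding \<alpha>_def \<beta>_def by (simp add: power2_eq_square algebra_simps)
  then have prod: "\<alpha> * \<beta> = 1"
    using PM by simp
  note sol = modular_equation_degree_3_solution[OF pos(1) x1 _ _ g0 g3 h R]
  have roots: "y1 / x * (g + h) = \<alpha>" "y2 / x * (g + h) = \<beta>"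
  proof -
    \<comment> \<open>The order of the two quotients assigns the smaller root to the tripled
      argument.\<close>
    have "y1 / x * (g + h) < y2 / x * (g + h)"
      using y12 pos g0 h by (intro mult_strict_right_mono divide_strict_right_mono) auto
    from quadratic_two_roots[OF this \<open>\<alpha> \<le> \<beta>\<close>] show "y1 / x * (g + h) = \<alpha>" "y2 / x * (g + h) = \<beta>"
      unfolding sum prod using sol(1)[OF pos(2) eq1] sol(1)[OF pos(3) eq2] by simp_all
  qed
  have unit: "(g + h) * (g - h) = 1"
    using h by (simp add: algebra_simps power2_eq_square)
  have solved: "y = x * (g - h) * \<tau>" if "y / x * (g + h) = \<tau>" for y \<tau>
  proof -
    have "x * (g - h) * \<tau> = y * ((g + h) * (g - h))"
      using pos unfolding that[symmetric] by simp
    then show ?thesis unfolding unit by simp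
  qed
  have gh: "g - h \<ge> 0"
    using unit g0 h by (smt (verit) mult_pos_neg)
  have hR: "h * R = sqrt (g ^ 6 - 1)"
    unfolding h_def R_def real_sqrt_mult[symmetric]
    by (rule arg_cong[of _ _ sqrt]) (simp add: algebra_simps eval_nat_numeral)
  \<comment> \<open>The expression under the fourth root is
    \<open>g^3 - h * R = x^2\<close>.\<close>
  have "root 4 (x\<^sup>2) = sqrt x"
    using pos by (intro real_root_pos_unique) (auto simp: power4_eq_xxxx power2_eq_square)
  then have root_eq: "root 4 (G ^ 12 - sqrt (G ^ 24 - 1)) = sqrt x"
    using sol(2)[OF pos(2) eq1] hR by (simp add: g_def flip: power_mult)
  have h_eq: "sqrt (G ^ 4 - sqrt (G ^ 8 - 1)) = sqrt (g - h)"
    by (simp add: g_def h_def flip: power_mult)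
  have P_eq: "(G ^ 8 + 1 + sqrt (G ^ 16 + G ^ 8 + 1)) / 2 = P"
    and M_eq: "(G ^ 8 - 1 + sqrt (G ^ 16 + G ^ 8 + 1)) / 2 = M"
    by (simp_all add: g_def P_def M_def R_def flip: power_mult)
  have S2_eq: "sqrt (y / 2) = 1 / sqrt 2 * sqrt x * sqrt (g - h) * v" if "y / x * (g + h) = v\<^sup>2" "v \<ge> 0" for y v
    unfolding solved[OF that(1)] using that(2) by (simp add: real_sqrt_mult real_sqrt_divide)
  have "S2 (exp (- (3 * s))) = 1 / sqrt 2 * sqrt x * sqrt (g - h) * (sqrt P - sqrt M)"
    using S2_eq_sqrt[of "3 * s"] S2_eq[of y1 "sqrt P - sqrt M"] roots(1) s PM by (simp add: y1_def \<alpha>_def)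
  moreover have "S2 (exp (- (s / 3))) = 1 / sqrt 2 * sqrt x * sqrt (g - h) * (sqrt P + sqrt M)"
    using S2_eq_sqrt[of "s / 3"] S2_eq[of y2 "sqrt P + sqrt M"] roots(2) s PM by (simp add: y2_def \<beta>_def)
  ultimately show ?thesis
    unfolding root_eq h_eq P_eq M_eq by (simp add: s_def mult.assoc)
qed

end
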